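(* Let $b>3$ be an integer coprime to $3$, and write $b=3k\pm1$ with $k$ a positive integer. For each integer sequence $r_1\ge\cdots\ge r_k\ge0$ set $$(\ell,s)=(k,r_k)\ \text{ if } b=3k+1,\qquad (\ell,s)=(k-1,r_k)\ \text{ if } b=3k-1,$$ let $\mu$ be the partition with conjugate $\mu'=(r_1+s,\ldots,r_\ell+s)$, of size $|\mu|=\sum_{i=1}^\ell(r_i+s)$, and fix an arbitrary ordering of the parts of $\mu$. For $M\ge0$ let $\mathcal T_M(\mu)$ be the set of tuples of one-row semistandard tableaux with entries in $\{1,2\}$, with row lengths the parts of $\mu$ in the fixed order, and with exactly $M$ entries (in total) equal to $1$. Then $$Z_{3,b}(q)=\sum_{r_1\ge\cdots\ge r_k\ge0}\frac1{(q)_{r_1}}\left(\prod_{i=1}^{k-1}\genfrac{[}{]}{0pt}{}{r_i}{r_{i+1}}_{q}\right)\sum_{M\ge0}\ \sum_{T\in\mathcal T_M(\mu)}q^{\,\sum_{i=1}^kr_i^2+sM-n(\mu)+\operatorname{coinv}(T)},$$ where $n(\mu)=\sum_{i=1}^\ell\binom{r_i+s}{2}$ and $\operatorname{coinv}(T)=n(\mu)-\operatorname{inv}(T)\ge0$. Although $\operatorname{inv}$ depends on the chosen ordering of the parts of $\mu$, the inner sum over $T$ does not.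
   Context: $(q)_m=\prod_{t=1}^m(1-q^t)$ for $m\ge0$. The Gaussian polynomial is $\genfrac{[}{]}{0pt}{}{N}{j}_q=\frac{(q)_N}{(q)_j(q)_{N-j}}$ if $0\le j\le N$, and $0$ otherwise. The series $Z_{3,b}(q)$. Let $\Gamma=\langle3,b\rangle\subset\mathbb N=\{0,1,\dots\}$ be the semigroup (containing $0$) generated by $3$ and $b$, and $\mathcal G=\mathbb N\setminus\Gamma$ (finite). Elements $\boldsymbol n=(n_i)_{i\in\mathcal G}$ are extended by $n_i=0$ for $i\notin\mathcal G$. With $\mathbf 1$ denoting indicators, put $$U_{3,b}(x)=\mathbf 1_{x\ge0}-\mathbf 1_{x\ge3}-\mathbf 1_{x\ge b}+\mathbf 1_{x\ge b+3},\qquad Q_{3,b}(\boldsymbol n)=\sum_{i,j\in\mathcal G}U_{3,b}(j-i)n_in_j,$$ $$\mathcal C_{3,b}=\{\boldsymbol n\in\mathbb R^{\mathcal G}:n_i\ge0,\ n_i\ge n_j\text{ whenever }i,j\in\mathcal G,\ i-j\in\Gamma\},$$ $$Z_{3,b}(q)=\sum_{\boldsymbol n\in\mathbb Z^{\mathcal G}\cap\mathcal C_{3,b}}q^{Q_{3,b}(\boldsymbol n)}\prod_{i\in\mathcal G}\frac{(q)_{n_i-n_{i-3-b}}}{(q)_{n_i-n_{i-3}}(q)_{n_i-n_{i-b}}},$$ a well-defined formal power series. Tableaux. A one-row semistandard tableau with entries in $\{1,2\}$ is a weakly increasing row of $1$'s and $2$'s, its cells lying in columns $1,2,\dots$ (left-justified).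 For a tuple $T=(T_1,T_2,\dots)$ of such rows, $\operatorname{inv}(T)$ (Schilling's inversion statistic) is the number of inversions: an inversion is, for some $p<p'$ and some column $i$, either a same-column pair consisting of an entry $2$ in column $i$ of $T_p$ and an entry $1$ in column $i$ of $T_{p'}$, or an adjacent-column pair consisting of an entry $1$ in column $i+1$ of $T_p$ and an entry $2$ in column $i$ of $T_{p'}$. *)

theory Defs
  imports "HOL-Analysis.Analysis" "HOL-Computational_Algebra.Formal_Power_Series"
begin

text \<open>
  Formal power series in \<open>q = fps_X\<close> are taken over the rationals. All infinite sums of
  series are \<open>has_sum\<close> / \<open>infsum\<close> with respect to the topology that the library puts on
  \<^typ>\<open>rat fps\<close>, which is the \<open>q\<close>-adic one.
\<close>

definition qpoch :: "nat \<Rightarrow> rat fps" where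
  "qpoch m = (\<Prod>t=1..m. 1 - fps_X ^ t)"

definition gauss_poly :: "nat \<Rightarrow> nat \<Rightarrow> rat fps" where
  "gauss_poly N j = (if j \<le> N then qpoch N / (qpoch j * qpoch (N - j)) else 0)"

text \<open>
  The semigroup and its gaps are sets of integers, so that index shifts such as \<open>i - 3 - b\<close>
  do not truncate; vectors indexed by the gaps are functions on the integers vanishing
  elsewhere.
\<close>

definition semigp :: "nat \<Rightarrow> int set" where
  "semigp b = {3 * int x + int b * int y | x y. True}"

definition gaps :: "nat \<Rightarrow> int set" where
  "gaps b = \<nat> - semigp b"

definition U :: "nat \<Rightarrow> int \<Rightarrow> int" where
  "U b x = of_bool (x \<ge> 0) - of_bool (x \<ge> 3) - of_bool (x \<ge> int b) + of_bool (x \<ge> int b + 3)"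

definition Q :: "nat \<Rightarrow> (int \<Rightarrow> int) \<Rightarrow> int" where
  "Q b n = (\<Sum>i\<in>gaps b. \<Sum>j\<in>gaps b. U b (j - i) * n i * n j)"

definition cone :: "nat \<Rightarrow> (int \<Rightarrow> real) set" where
  "cone b = {n. (\<forall>i. i \<notin> gaps b \<longrightarrow> n i = 0) \<and> (\<forall>i\<in>gaps b. n i \<ge> 0) \<and>
                (\<forall>i\<in>gaps b. \<forall>j\<in>gaps b. i - j \<in> semigp b \<longrightarrow> n i \<ge> n j)}"

definition cone_points :: "nat \<Rightarrow> (int \<Rightarrow> int) set" where
  "cone_points b = {n. (\<lambda>i. real_of_int (n i)) \<in> cone b}"

text \<open>
  On the lattice points of the cone the arguments of \<open>nat\<close> below are nonnegative. For the
  exponent this is part of the theorem; for the differences \<open>n i - n j\<close> it is immediate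
  from the definition of the cone.
\<close>

definition Z_term :: "nat \<Rightarrow> (int \<Rightarrow> int) \<Rightarrow> rat fps" where
  "Z_term b n = fps_X ^ nat (Q b n) *
     (\<Prod>i\<in>gaps b. qpoch (nat (n i - n (i - 3 - int b))) /
        (qpoch (nat (n i - n (i - 3))) * qpoch (nat (n i - n (i - int b)))))"

definition Z :: "nat \<Rightarrow> rat fps" where
  "Z b = (\<Sum>\<^sub>\<infinity>n\<in>cone_points b. Z_term b n)"

definition one_row_ssyt :: "nat list \<Rightarrow> bool" where
  "one_row_ssyt R \<longleftrightarrow> sorted R \<and> set R \<subseteq> {1, 2}"

definition tableaux :: "nat list \<Rightarrow> nat \<Rightarrow> nat list list set" where
  "tableaux lam M = {T. map length T = lam \<and> (\<forall>R\<in>set T. one_row_ssyt R) \<and>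
                        sum_list (map (\<lambda>R. count_list R 1) T) = M}"

text \<open>Rows and columns are numbered from 0 here.\<close>

definition inversions :: "nat list list \<Rightarrow> nat" where
  "inversions T =
     card {(p, p', i). p < p' \<and> p' < length T \<and> i < length (T ! p) \<and> i < length (T ! p') \<and>
                       T ! p ! i = 2 \<and> T ! p' ! i = 1} +
     card {(p, p', i). p < p' \<and> p' < length T \<and> Suc i < length (T ! p) \<and> i < length (T ! p') \<and>
                       T ! p ! Suc i = 1 \<and> T ! p' ! i = 2}"

text \<open>Sequences \<open>r\<^sub>1 \<ge> \<dots> \<ge> r\<^sub>k \<ge> 0\<close>, extended by 0 so that equal sequences are equal functions.\<close>

definition row_seqs :: "nat \<Rightarrow> (nat \<Rightarrow> nat) set" where
  "row_seqs k = {r. (\<forall>i. i \<notin> {1..k} \<longrightarrow> r i = 0) \<and> (\<forall>i\<in>{1..<k}. r (Suc i) \<le> r i)}"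

definition ell :: "nat \<Rightarrow> nat \<Rightarrow> nat" where
  "ell b k = (if b = 3 * k + 1 then k else k - 1)"

text \<open>The shift \<open>s\<close> is the last entry \<open>r k\<close> for both residues of \<open>b\<close> modulo 3.\<close>

definition mu_conj :: "nat \<Rightarrow> nat \<Rightarrow> (nat \<Rightarrow> nat) \<Rightarrow> nat \<Rightarrow> nat" where
  "mu_conj b k r i = (if i \<in> {1..ell b k} then r i + r k else 0)"

text \<open>
  \<open>parts_ordering c lam\<close>: the list \<open>lam\<close> consists of the (positive) parts, in some order, of
  the partition whose conjugate is \<open>(c 1, c 2, \<dots>)\<close>.
\<close>

definition parts_ordering :: "(nat \<Rightarrow> nat) \<Rightarrow> nat list \<Rightarrow> bool" where
  "parts_ordering c lam \<longleftrightarrow> 0 \<notin> set lam \<and> (\<forall>i\<ge>1. length (filter (\<lambda>m. i \<le> m) lam) = c i)"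

definition n_mu :: "nat \<Rightarrow> nat \<Rightarrow> (nat \<Rightarrow> nat) \<Rightarrow> nat" where
  "n_mu b k r = (\<Sum>i=1..ell b k. (r i + r k) choose 2)"

definition coinv :: "nat \<Rightarrow> nat \<Rightarrow> (nat \<Rightarrow> nat) \<Rightarrow> nat list list \<Rightarrow> int" where
  "coinv b k r T = int (n_mu b k r) - int (inversions T)"

definition expo :: "nat \<Rightarrow> nat \<Rightarrow> (nat \<Rightarrow> nat) \<Rightarrow> nat \<Rightarrow> nat list list \<Rightarrow> int" where
  "expo b k r M T = (\<Sum>i=1..k. int (r i) ^ 2) + int (r k) * int M - int (n_mu b k r) + coinv b k r T"

text \<open>That \<open>expo\<close> is nonnegative, so that \<open>nat\<close> does not truncate, is part of the theorem.
  For fixed \<open>lam\<close>, \<open>tableaux lam M\<close> is finite, and empty for \<open>M > sum_list lam\<close>, so the infinite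
  sum of \<open>tableau_sum\<close> over \<open>M\<close> in the theorem is a finite one.\<close>

definition tableau_sum :: "nat \<Rightarrow> nat \<Rightarrow> (nat \<Rightarrow> nat) \<Rightarrow> nat list \<Rightarrow> nat \<Rightarrow> rat fps" where
  "tableau_sum b k r lam M = (\<Sum>T\<in>tableaux lam M. fps_X ^ nat (expo b k r M T))"

end

theory Submission
  imports Defs
begin

text \<open>
  Write \<open>b = 3 l + e\<close> with \<open>e = 1\<close> or \<open>e = 2\<close>. The gaps are \<open>b - 3 j\<close> (\<open>1 \<le> j \<le> l\<close>) and
  \<open>2 b - 3 j\<close> (\<open>1 \<le> j \<le> l + k\<close>); let \<open>x\<^sub>j\<close> and \<open>y\<^sub>j\<close> be the corresponding entries of a lattice point
  of the cone, and put \<open>r\<^sub>j = y\<^sub>j\<close> for \<open>j \<le> k\<close>, \<open>z\<^sub>j = y\<^sub>k\<^sub>+\<^sub>j\<close> for \<open>j \<le> l\<close> and \<open>s = r\<^sub>k\<close>. For fixed \<open>r\<close> the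
  pairs \<open>(x\<^sub>j, z\<^sub>j)\<close> form a finite set of chains, and with \<open>c\<^sub>j = x\<^sub>j + z\<^sub>j\<close> the \<open>q\<close>-Vandermonde identity
  \[
    \left[{r_j+s-c_{j+1} \atop c_j-c_{j+1}}\right] = \sum q^{v_j}
    \left[{r_j-x_{j+1} \atop x_j-x_{j+1}}\right] \left[{s-z_{j+1} \atop z_j-z_{j+1}}\right]
  \]
  turns the sum over them into a sum over chains \<open>c\<close> alone, because the quadratic form of the cone
  equals the sum of \<open>c\<^sub>j\<^sup>2 + r\<^sub>j\<^sup>2 - c\<^sub>j r\<^sub>j + v\<^sub>j\<close> over \<open>j \<le> l\<close>, plus \<open>s\<^sup>2\<close> if \<open>e = 2\<close>. On the other
  side, \<open>c\<^sub>j\<close> is the number of rows of a tableau with a 1 in column \<open>j\<close>, and the tableaux with given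
  \<open>c\<close> are counted by the same product of Gaussian polynomials, whatever the order of the rows.
\<close>

section \<open>Gaussian polynomials\<close>

lemma qpoch_Suc: "qpoch (Suc m) = qpoch m * (1 - fps_X ^ Suc m)"
  by (simp add: qpoch_def)

lemma qpoch_0 [simp]: "qpoch 0 = 1"
  by (simp add: qpoch_def)

lemma qpoch_nth_0 [simp]: "fps_nth (qpoch m) 0 = 1"
  by (induction m) (simp_all add: qpoch_Suc)

lemma qpoch_nonzero [simp]: "qpoch m \<noteq> 0"
  using qpoch_nth_0[of m] by fastforce

lemma qpoch_times_inverse [simp]: "qpoch m * inverse (qpoch m) = 1"
  using inverse_mult_eq_1[of "qpoch m"] by (simp add: mult.commute)

lemma divide_qpoch: "f / qpoch m = f * inverse (qpoch m)"
  by (rule fps_divide_unit) simp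

lemma divide_qpoch2: "f / (qpoch m * qpoch n) = f * inverse (qpoch m) * inverse (qpoch n)"
  by (subst fps_divide_unit) (simp_all add: fps_inverse_mult mult.assoc)

lemma gauss_poly_eq:
  "j \<le> N \<Longrightarrow> gauss_poly N j = qpoch N * inverse (qpoch j) * inverse (qpoch (N - j))"
  by (simp add: gauss_poly_def divide_qpoch2)

lemma gauss_poly_eq_0 [simp]: "N < j \<Longrightarrow> gauss_poly N j = 0"
  by (simp add: gauss_poly_def)

lemma gauss_poly_nonzeroD: "gauss_poly N j \<noteq> 0 \<Longrightarrow> j \<le> N"
  using gauss_poly_eq_0 not_le by blast

lemma gauss_poly_0_right [simp]: "gauss_poly N 0 = 1"
  by (simp add: gauss_poly_eq)

lemma gauss_poly_self [simp]: "gauss_poly N N = 1"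
  by (simp add: gauss_poly_eq)

lemma gauss_poly_mult:
  "j \<le> N \<Longrightarrow> gauss_poly N j * (qpoch j * qpoch (N - j)) = qpoch N"
proof -
  assume "j \<le> N"
  then have "gauss_poly N j * (qpoch j * qpoch (N - j)) =
      qpoch N * (qpoch j * inverse (qpoch j)) * (qpoch (N - j) * inverse (qpoch (N - j)))"
    by (simp only: gauss_poly_eq mult_ac)
  then show ?thesis by simp
qed

text \<open>Multiplied by the common denominator (q)_{m+1} (q)_{N-m}, the claim is (q)_N times 1 -
  q^(N+1) = q^(m+1) (1 - q^(N-m)) + (1 - q^(m+1)).\<close>

lemma gauss_poly_pascal:
  "gauss_poly (Suc N) (Suc m) = fps_X ^ Suc m * gauss_poly N (Suc m) + gauss_poly N m"
proof -
  consider "N < m" | "N = m" | "m < N" by linarith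
  then show ?thesis
  proof cases
    case 3
    define c :: "rat fps" where "c = qpoch (Suc m) * qpoch (N - m)"
    obtain d where d: "N = Suc (m + d)" using 3 less_imp_Suc_add by blast
    have "gauss_poly (Suc N) (Suc m) * c = qpoch (Suc N)"
      using gauss_poly_mult[of "Suc m" "Suc N"] 3 by (simp add: c_def)
    moreover have "gauss_poly N (Suc m) * c = qpoch N * (1 - fps_X ^ (N - m))"
    proof -
      have "c = qpoch (Suc m) * qpoch (N - Suc m) * (1 - fps_X ^ (N - m))"
        by (simp add: c_def d qpoch_Suc algebra_simps)
      then show ?thesis using gauss_poly_mult[of "Suc m" N] 3
        by (metis Suc_leI mult.assoc)
    qed
    moreover have "gauss_poly N m * c = qpoch N * (1 - fps_X ^ Suc m)"
    proof -
      have "c = qpoch m * qpoch (N - m) * (1 - fps_X ^ Suc m)"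
        by (simp add: c_def qpoch_Suc algebra_simps)
      then show ?thesis using gauss_poly_mult[of m N] 3
        by (metis less_imp_le mult.assoc)
    qed
    moreover have "(fps_X ^ Suc N :: rat fps) = fps_X ^ Suc m * fps_X ^ (N - m)"
      using 3 by (metis add_Suc le_add_diff_inverse less_imp_le power_add)
    then have "qpoch (Suc N) =
        fps_X ^ Suc m * (qpoch N * (1 - fps_X ^ (N - m))) + qpoch N * (1 - fps_X ^ Suc m)"
      by (simp only: qpoch_Suc[of N]) (simp only: algebra_simps, simp)
    ultimately have "gauss_poly (Suc N) (Suc m) * c =
        fps_X ^ Suc m * (gauss_poly N (Suc m) * c) + gauss_poly N m * c"
      by (simp only:)
    then have "gauss_poly (Suc N) (Suc m) * c =
        (fps_X ^ Suc m * gauss_poly N (Suc m) + gauss_poly N m) * c"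
      by (simp only: distrib_right mult.assoc)
    moreover have "c \<noteq> 0" by (simp add: c_def)
    ultimately show ?thesis by (metis mult_right_cancel)
  qed auto
qed

text \<open>Induction on B, with q-Pascal applied to the second factor. Truncated subtraction in the
  exponent is harmless: if n - a exceeds B, the second Gaussian polynomial is 0.\<close>

lemma gauss_poly_vandermonde:
  "gauss_poly (A + B) n =
     (\<Sum>a\<le>n. fps_X ^ (a * (B - (n - a))) * gauss_poly A a * gauss_poly B (n - a))"
proof (induction B arbitrary: n)
  case 0
  have "(\<Sum>a\<le>n. fps_X ^ (a * (0 - (n - a))) * gauss_poly A a * gauss_poly 0 (n - a)) =
        (\<Sum>a\<le>n. if a = n then gauss_poly A n else 0)"
    by (intro sum.cong) auto
  then show ?case by simp
next
  case (Suc B)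
  show ?case
  proof (cases n)
    case (Suc m)
    have "(\<Sum>a\<le>n. fps_X ^ (a * (Suc B - (n - a))) * gauss_poly A a * gauss_poly (Suc B) (n - a)) =
          (\<Sum>a\<le>m. fps_X ^ (a * (Suc B - (n - a))) * gauss_poly A a * gauss_poly (Suc B) (n - a))
            + fps_X ^ (n * Suc B) * gauss_poly A n"
      by (simp add: Suc)
    also have "(\<Sum>a\<le>m. fps_X ^ (a * (Suc B - (n - a))) * gauss_poly A a * gauss_poly (Suc B) (n - a)) =
       (\<Sum>a\<le>m. fps_X ^ n * (fps_X ^ (a * (B - (n - a))) * gauss_poly A a * gauss_poly B (n - a)) +
               fps_X ^ (a * (B - (m - a))) * gauss_poly A a * gauss_poly B (m - a))"
    proof (intro sum.cong refl)
      fix a assume a: "a \<in> {..m}"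
      then have na: "n - a = Suc (m - a)" by (simp add: Suc Suc_diff_le)
      have "fps_X ^ (a * (Suc B - (n - a))) * (fps_X ^ (n - a) * gauss_poly B (n - a)) =
            fps_X ^ n * (fps_X ^ (a * (B - (n - a))) * gauss_poly B (n - a))"
      proof (cases "n - a \<le> B")
        case True
        then obtain d where "B = n - a + d" using le_Suc_ex by blast
        moreover obtain e where "m = a + e" using a le_Suc_ex by auto
        ultimately have "a * (Suc B - (n - a)) + (n - a) = n + a * (B - (n - a))"
          by (simp add: Suc algebra_simps)
        then show ?thesis by (metis mult.assoc power_add)
      qed simp
      then show "fps_X ^ (a * (Suc B - (n - a))) * gauss_poly A a * gauss_poly (Suc B) (n - a) =
          fps_X ^ n * (fps_X ^ (a * (B - (n - a))) * gauss_poly A a * gauss_poly B (n - a)) +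
          fps_X ^ (a * (B - (m - a))) * gauss_poly A a * gauss_poly B (m - a)"
        by (simp add: na gauss_poly_pascal algebra_simps)
    qed
    also have "\<dots> + fps_X ^ (n * Suc B) * gauss_poly A n =
        fps_X ^ n * (\<Sum>a\<le>n. fps_X ^ (a * (B - (n - a))) * gauss_poly A a * gauss_poly B (n - a)) +
        (\<Sum>a\<le>m. fps_X ^ (a * (B - (m - a))) * gauss_poly A a * gauss_poly B (m - a))"
      by (simp add: Suc sum.distrib sum_distrib_left distrib_left power_add algebra_simps)
    also have "\<dots> = gauss_poly (A + Suc B) n"
      by (simp only: Suc.IH[symmetric] gauss_poly_pascal Suc add_Suc_right)
    finally show ?thesis by simp
  qed simp
qed

section \<open>Inversions between sets of positions\<close>

definition ascents :: "nat set \<Rightarrow> nat set \<Rightarrow> nat" where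
  "ascents S T = card {(p, p'). p \<in> S \<and> p' \<in> T \<and> p < p'}"

lemma finite_ascents:
  "finite S \<Longrightarrow> finite T \<Longrightarrow> finite {(p, p'). p \<in> S \<and> p' \<in> T \<and> p < p'}"
  by (rule finite_subset[of _ "S \<times> T"]) auto

lemma ascents_Un_left:
  assumes "finite S" "finite S'" "finite T" "S \<inter> S' = {}"
  shows "ascents (S \<union> S') T = ascents S T + ascents S' T"
proof -
  have "{(p, p'). p \<in> S \<union> S' \<and> p' \<in> T \<and> p < p'} =
        {(p, p'). p \<in> S \<and> p' \<in> T \<and> p < p'} \<union> {(p, p'). p \<in> S' \<and> p' \<in> T \<and> p < p'}"
    by auto
  then show ?thesis
    unfolding ascents_def using assms
    by (simp only:) (subst card_Un_disjoint; auto intro: finite_ascents)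
qed

lemma ascents_swap:
  assumes "finite S" "finite T" "S \<inter> T = {}"
  shows "ascents S T + ascents T S = card S * card T"
proof -
  let ?f = "\<lambda>(p::nat, p'::nat). (p', p)"
  have "ascents T S = card (?f ` {(p, p'). p \<in> T \<and> p' \<in> S \<and> p < p'})"
    unfolding ascents_def by (rule card_image[symmetric]) (auto simp: inj_on_def)
  also have "?f ` {(p, p'). p \<in> T \<and> p' \<in> S \<and> p < p'} = {(p, p'). p \<in> S \<and> p' \<in> T \<and> p' < p}"
    by auto
  finally have "ascents S T + ascents T S =
      card ({(p, p'). p \<in> S \<and> p' \<in> T \<and> p < p'} \<union> {(p, p'). p \<in> S \<and> p' \<in> T \<and> p' < p})"
    unfolding ascents_def using assms
    by (subst card_Un_disjoint) (auto intro: finite_ascents finite_subset[of _ "S \<times> T"])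
  also have "{(p, p'). p \<in> S \<and> p' \<in> T \<and> p < p'} \<union> {(p, p'). p \<in> S \<and> p' \<in> T \<and> p' < p} = S \<times> T"
    using assms(3) by (auto simp: disjoint_iff) (metis linorder_neqE_nat)
  finally show ?thesis by (simp add: card_cartesian_product)
qed

lemma ascents_insert_left_max:
  assumes "\<And>p. p \<in> T \<Longrightarrow> p < w"
  shows "ascents (insert w S) T = ascents S T"
  unfolding ascents_def using assms by (intro arg_cong[where f = card]) fastforce

lemma ascents_insert_right_max:
  assumes "finite S" "finite T" "\<And>p. p \<in> S \<Longrightarrow> p < w" "w \<notin> T"
  shows "ascents S (insert w T) = ascents S T + card S"
proof -
  have "{(p, p'). p \<in> S \<and> p' \<in> insert w T \<and> p < p'} =
        {(p, p'). p \<in> S \<and> p' \<in> T \<and> p < p'} \<union> (\<lambda>p. (p, w)) ` S"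
    using assms(3) by auto
  moreover have "card ((\<lambda>p. (p, w)) ` S) = card S"
    by (rule card_image) (auto simp: inj_on_def)
  ultimately show ?thesis
    unfolding ascents_def using assms
    by (simp only:) (subst card_Un_disjoint; auto intro: finite_ascents)
qed

text \<open>Induction on the largest element w. If w is not in S, it ends an ascent from each of the
  m elements of S, which gives q^m; if w is in S, it adds nothing. This is q-Pascal. Only
  \<open>card W\<close> enters, which is why the order of the rows will not matter.\<close>

lemma sum_subsets_ascents:
  assumes "finite W"
  shows "(\<Sum>S | S \<subseteq> W \<and> card S = m. fps_X ^ ascents S (W - S)) = gauss_poly (card W) m"
  using assms
proof (induction W arbitrary: m rule: finite_linorder_max_induct)
  case empty
  have "{S. S \<subseteq> {} \<and> card S = m} = (if m = 0 then {{}} else {} :: nat set set)" by auto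
  then show ?case by (simp add: ascents_def)
next
  case (insert w W)
  have w: "w \<notin> W" using insert.hyps by auto
  note fin = \<open>finite W\<close>
  have out: "(\<Sum>S | S \<subseteq> W \<and> card S = n. fps_X ^ ascents S (insert w W - S)) =
      fps_X ^ n * gauss_poly (card W) n" for n
  proof -
    have "ascents S (insert w W - S) = n + ascents S (W - S)" if "S \<subseteq> W" "card S = n" for S
    proof -
      have "insert w W - S = insert w (W - S)" using that w by auto
      then show ?thesis
        using ascents_insert_right_max[of S "W - S" w] that insert.hyps w finite_subset[OF that(1) fin]
        by (auto simp: subset_iff)
    qed
    then have "(\<Sum>S | S \<subseteq> W \<and> card S = n. fps_X ^ ascents S (insert w W - S)) =
        (\<Sum>S | S \<subseteq> W \<and> card S = n. fps_X ^ n * fps_X ^ ascents S (W - S) :: rat fps)"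
      by (intro sum.cong) (auto simp: power_add)
    then show ?thesis by (simp add: insert.IH flip: sum_distrib_left)
  qed
  show ?case
  proof (cases m)
    case 0
    have "{S. S \<subseteq> insert w W \<and> card S = m} = {S. S \<subseteq> W \<and> card S = m}"
      using fin by (auto simp: 0 card_eq_0_iff dest: finite_subset)
    then show ?thesis using out[of m] by (simp add: 0)
  next
    case (Suc n)
    have split: "{S. S \<subseteq> insert w W \<and> card S = m} =
        {S. S \<subseteq> W \<and> card S = m} \<union> insert w ` {S. S \<subseteq> W \<and> card S = n}" (is "?L = ?A \<union> ?B")
    proof (intro equalityI subsetI)
      fix S assume S: "S \<in> ?L"
      show "S \<in> ?A \<union> ?B"
      proof (cases "w \<in> S")
        case True
        then have "S = insert w (S - {w})" "S - {w} \<subseteq> W" "card (S - {w}) = n"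
          using S fin by (auto simp: Suc card_Diff_singleton)
        then show ?thesis by blast
      qed (use S in auto)
    next
      fix S assume "S \<in> ?A \<union> ?B"
      then show "S \<in> ?L"
      proof
        assume "S \<in> ?B"
        then obtain S' where S': "S = insert w S'" "S' \<subseteq> W" "card S' = n" by auto
        then have "finite S'" "w \<notin> S'" using fin w finite_subset by auto
        with S' show ?thesis by (auto simp: Suc)
      qed auto
    qed
    have "(\<Sum>S\<in>insert w ` {S. S \<subseteq> W \<and> card S = n}. fps_X ^ ascents S (insert w W - S)) =
          (\<Sum>S | S \<subseteq> W \<and> card S = n. fps_X ^ ascents (insert w S) (insert w W - insert w S) :: rat fps)"
      using w by (subst sum.reindex) (auto simp: inj_on_def insert_ident subset_iff)
    also have "\<dots> = (\<Sum>S | S \<subseteq> W \<and> card S = n. fps_X ^ ascents S (W - S))"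
    proof (intro sum.cong refl arg_cong2[where f = power])
      fix S assume "S \<in> {S. S \<subseteq> W \<and> card S = n}"
      moreover have "insert w W - insert w S = W - S" using w by auto
      ultimately show "ascents (insert w S) (insert w W - insert w S) = ascents S (W - S)"
        using insert.hyps by (auto intro!: ascents_insert_left_max)
    qed
    also have "\<dots> = gauss_poly (card W) n" by (rule insert.IH)
    finally have in_: "(\<Sum>S\<in>insert w ` {S. S \<subseteq> W \<and> card S = n}. fps_X ^ ascents S (insert w W - S)) =
      gauss_poly (card W) n" .
    have "(\<Sum>S | S \<subseteq> insert w W \<and> card S = m. fps_X ^ ascents S (insert w W - S)) =
        fps_X ^ m * gauss_poly (card W) m + gauss_poly (card W) n"
      unfolding split using fin w
      by (subst sum.union_disjoint) (auto simp: out in_)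
    then show ?thesis using fin w by (simp add: Suc gauss_poly_pascal)
  qed
qed

section \<open>Weighted chains\<close>

text \<open>
  A chain starts at the state \<open>f (l + 1) = u\<close> and steps down to \<open>f 1\<close>; \<open>St i u\<close> are the
  states \<open>f i\<close> that may follow \<open>f (i + 1) = u\<close>.
\<close>

primrec chain_sum ::
    "(nat \<Rightarrow> 'a \<Rightarrow> 'a set) \<Rightarrow> (nat \<Rightarrow> 'a \<Rightarrow> 'a \<Rightarrow> 'b::comm_semiring_1) \<Rightarrow> nat \<Rightarrow> 'a \<Rightarrow> 'b" where
  "chain_sum St w 0 u = 1"
| "chain_sum St w (Suc l) u = (\<Sum>v\<in>St (Suc l) u. w (Suc l) u v * chain_sum St w l v)"

text \<open>Outside {1..l+1} a chain has the dummy value \<open>u0\<close>, so that chains with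
  equal states are equal functions.\<close>

definition step_chains :: "(nat \<Rightarrow> 'a \<Rightarrow> 'a set) \<Rightarrow> 'a \<Rightarrow> nat \<Rightarrow> 'a \<Rightarrow> (nat \<Rightarrow> 'a) set" where
  "step_chains St u0 l u = {f. f (Suc l) = u \<and> (\<forall>i. i \<notin> {1..Suc l} \<longrightarrow> f i = u0) \<and>
                          (\<forall>i\<in>{1..l}. f i \<in> St i (f (Suc i)))}"

text \<open>Unrolls the recursion: a chain of length l + 1 is its state v at l + 1 together with a
  chain of length l starting at v, whose entry at l + 2 is reset to the dummy value.\<close>

lemma chain_sum_eq_aux:
  assumes fin: "\<And>i u. finite (St i u)"
  shows "finite (step_chains St u0 l u) \<and>
    chain_sum St w l u = (\<Sum>f\<in>step_chains St u0 l u. \<Prod>i=1..l. w i (f (Suc i)) (f i))"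
proof (induction l arbitrary: u)
  case 0
  have "step_chains St u0 0 u = {(\<lambda>_. u0)(1 := u)}"
    by (auto simp: step_chains_def fun_eq_iff)
  then show ?case by simp
next
  case (Suc l)
  let ?A = "SIGMA v:St (Suc l) u. step_chains St u0 l v"
  let ?i = "\<lambda>(v, f). f(Suc (Suc l) := u)"
  let ?j = "\<lambda>g. (g (Suc l), g(Suc (Suc l) := u0))"
  have ij: "?j g \<in> ?A" "?i (?j g) = g" if "g \<in> step_chains St u0 (Suc l) u" for g
    using that by (auto simp: step_chains_def fun_eq_iff)
  have ji: "?i vf \<in> step_chains St u0 (Suc l) u" "?j (?i vf) = vf" if "vf \<in> ?A" for vf
    using that by (auto simp: step_chains_def fun_eq_iff le_Suc_eq)
  have "finite ?A" using fin Suc.IH by auto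
  moreover have "step_chains St u0 (Suc l) u = ?i ` ?A"
  proof (intro equalityI subsetI)
    fix g assume "g \<in> step_chains St u0 (Suc l) u"
    then show "g \<in> ?i ` ?A" using ij[of g] by (intro image_eqI[of g ?i "?j g"]) auto
  next
    fix g assume "g \<in> ?i ` ?A"
    then show "g \<in> step_chains St u0 (Suc l) u" using ji(1) by blast
  qed
  ultimately have "finite (step_chains St u0 (Suc l) u)" by simp
  moreover have "chain_sum St w (Suc l) u =
      (\<Sum>v\<in>St (Suc l) u. \<Sum>f\<in>step_chains St u0 l v. w (Suc l) u v * (\<Prod>i=1..l. w i (f (Suc i)) (f i)))"
    by (simp add: Suc.IH sum_distrib_left)
  moreover have "\<dots> = (\<Sum>(v, f)\<in>?A. w (Suc l) u v * (\<Prod>i=1..l. w i (f (Suc i)) (f i)))"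
    using fin Suc.IH by (subst sum.Sigma) auto
  moreover have "\<dots> = (\<Sum>f\<in>step_chains St u0 (Suc l) u. \<Prod>i=1..Suc l. w i (f (Suc i)) (f i))"
  proof (rule sum.reindex_bij_witness[of _ ?j ?i])
    fix vf assume vf: "vf \<in> ?A"
    obtain v f where [simp]: "vf = (v, f)" by force
    have "f (Suc l) = v" using vf by (simp add: step_chains_def)
    then show "(\<Prod>i=1..Suc l. w i (?i vf (Suc i)) (?i vf i)) =
        (case vf of (v, f) \<Rightarrow> w (Suc l) u v * (\<Prod>i=1..l. w i (f (Suc i)) (f i)))"
      by (simp add: mult.commute)
  qed (use ij ji in blast)+
  ultimately show ?case by simp
qed

lemmas finite_step_chains = chain_sum_eq_aux[THEN conjunct1]
lemmas chain_sum_eq = chain_sum_eq_aux[THEN conjunct2]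

text \<open>Strong lumpability: if the total weight of the moves from u into a class depends on u
  only through its own class, classes may replace states. \<open>R i\<close> holds the states that
  step i may leave, that is, the values of f (i + 1).\<close>

lemma chain_sum_lump:
  assumes fin: "\<And>i u. finite (St i u)" "\<And>i u. finite (St' i u)"
    and step: "\<And>i u v. 1 \<le> i \<Longrightarrow> i < l \<Longrightarrow> u \<in> R (Suc i) \<Longrightarrow> v \<in> St (Suc i) u \<Longrightarrow> v \<in> R i"
    and maps: "\<And>i u v. 1 \<le> i \<Longrightarrow> i \<le> l \<Longrightarrow> u \<in> R i \<Longrightarrow> v \<in> St i u \<Longrightarrow> \<phi> v \<in> St' i (\<phi> u)"
    and weight: "\<And>i u t. 1 \<le> i \<Longrightarrow> i \<le> l \<Longrightarrow> u \<in> R i \<Longrightarrow> t \<in> St' i (\<phi> u) \<Longrightarrow>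
        (\<Sum>v | v \<in> St i u \<and> \<phi> v = t. w i u v) = w' i (\<phi> u) t"
    and "l = 0 \<or> u \<in> R l"
  shows "chain_sum St w l u = chain_sum St' w' l (\<phi> u)"
  using step maps weight \<open>l = 0 \<or> u \<in> R l\<close>
proof (induction l arbitrary: u)
  case (Suc l)
  have u: "u \<in> R (Suc l)" using Suc.prems(4) by simp
  have IH: "chain_sum St w l v = chain_sum St' w' l (\<phi> v)" if "v \<in> St (Suc l) u" for v
  proof (rule Suc.IH)
    show "l = 0 \<or> v \<in> R l"
      using Suc.prems(1)[of l u v] u that by (cases l) auto
  qed (use Suc.prems(1-3) in auto)
  have "chain_sum St w (Suc l) u =
      (\<Sum>v\<in>St (Suc l) u. w (Suc l) u v * chain_sum St' w' l (\<phi> v))"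
    by (simp add: IH)
  also have "\<dots> = (\<Sum>t\<in>St' (Suc l) (\<phi> u).
      \<Sum>v | v \<in> St (Suc l) u \<and> \<phi> v = t. w (Suc l) u v * chain_sum St' w' l (\<phi> v))"
    using Suc.prems(2) u by (intro sum.group[symmetric] fin) auto
  also have "\<dots> = (\<Sum>t\<in>St' (Suc l) (\<phi> u).
      (\<Sum>v | v \<in> St (Suc l) u \<and> \<phi> v = t. w (Suc l) u v) * chain_sum St' w' l t)"
    by (simp add: sum_distrib_right)
  also have "\<dots> = chain_sum St' w' (Suc l) (\<phi> u)"
    using Suc.prems(3) u by simp
  finally show ?case .
qed simp

lemma poly_chain_sum:
  "poly (chain_sum St w l u) y = chain_sum St (\<lambda>i u v. poly (w i u v) y) l u"
  by (induction l arbitrary: u) (simp_all add: poly_sum)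

section \<open>Lumping of set chains and of pair chains\<close>

text \<open>
  Both the tableaux and the lattice points of the cone over a fixed \<open>r\<close> become weighted
  chains that lump to the same chains of numbers \<open>c\<^sub>1 \<ge> c\<^sub>2 \<ge> \<dots>\<close>; the indeterminate of the
  polynomial ring marks \<open>c\<^sub>1 + c\<^sub>2 + \<dots>\<close>.
\<close>

definition quad :: "nat \<Rightarrow> nat \<Rightarrow> nat" where
  "quad r c = c ^ 2 + r ^ 2 - c * r"

lemma int_quad: "int (quad r c) = int c ^ 2 + int r ^ 2 - int c * int r"
proof -
  have "c * r \<le> c ^ 2 + r ^ 2"
  proof (cases "c \<le> r")
    case True
    then have "c * r \<le> r * r" by (rule mult_right_mono) simp
    then show ?thesis unfolding power2_eq_square by linarith
  next
    case False
    then have "c * r \<le> c * c" by (intro mult_left_mono) simp_all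
    then show ?thesis unfolding power2_eq_square by linarith
  qed
  then show ?thesis by (simp add: quad_def of_nat_diff)
qed

definition num_step :: "(nat \<Rightarrow> nat) \<Rightarrow> nat \<Rightarrow> nat \<Rightarrow> nat \<Rightarrow> nat set" where
  "num_step r s i c' = {c'..r i + s}"

definition num_weight :: "(nat \<Rightarrow> nat) \<Rightarrow> nat \<Rightarrow> nat \<Rightarrow> nat \<Rightarrow> nat \<Rightarrow> rat fps" where
  "num_weight r s i c' c = fps_X ^ quad (r i) c * gauss_poly (r i + s - c') (c - c')"

definition set_step :: "(nat \<Rightarrow> nat set) \<Rightarrow> nat \<Rightarrow> nat set \<Rightarrow> nat set set" where
  "set_step R i A' = {A. A' \<subseteq> A \<and> A \<subseteq> R i}"

text \<open>With A' and A the sets of rows that have a 1 in columns i + 1 and i, this is the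
  contribution of column i to the exponent of a tableau; see \<open>expo_eq\<close>.\<close>

definition set_exp :: "(nat \<Rightarrow> nat set) \<Rightarrow> (nat \<Rightarrow> nat) \<Rightarrow> nat \<Rightarrow> nat set \<Rightarrow> nat set \<Rightarrow> nat" where
  "set_exp R r i A' A = quad (r i) (card A) + ascents (A - A') (R i - A)"

lemma finite_set_step: "finite (R i) \<Longrightarrow> finite (set_step R i A')"
  unfolding set_step_def by (rule finite_subset[of _ "Pow (R i)"]) auto

lemma sum_monom: "(\<Sum>x\<in>A. monom (f x) n) = monom (\<Sum>x\<in>A. f x) n"
  by (induction A rule: infinite_finite_induct) (simp_all add: add_monom)

text \<open>Removing A' turns the sets A into the subsets S = A - A' of W - A', and W - A is the
  complement of S there.\<close>

lemma sum_set_step: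
  assumes "finite W" "A' \<subseteq> W" "card A' \<le> t"
  shows "(\<Sum>A | (A' \<subseteq> A \<and> A \<subseteq> W) \<and> card A = t. fps_X ^ ascents (A - A') (W - A)) =
    gauss_poly (card W - card A') (t - card A')"
proof -
  have fA: "finite A'" using assms finite_subset by blast
  have "(\<Sum>A | (A' \<subseteq> A \<and> A \<subseteq> W) \<and> card A = t. fps_X ^ ascents (A - A') (W - A)) =
      (\<Sum>S | S \<subseteq> W - A' \<and> card S = t - card A'. fps_X ^ ascents S (W - A' - S) :: rat fps)"
  proof (rule sum.reindex_bij_witness[of _ "\<lambda>S. A' \<union> S" "\<lambda>A. A - A'"])
    fix A assume A: "A \<in> {A. (A' \<subseteq> A \<and> A \<subseteq> W) \<and> card A = t}"
    then have fin: "finite A" using assms finite_subset by blast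
    show "A' \<union> (A - A') = A" using A by auto
    show "A - A' \<in> {S. S \<subseteq> W - A' \<and> card S = t - card A'}"
      using A fA fin by (auto simp: card_Diff_subset)
    have "W - A' - (A - A') = W - A" using A by auto
    then show "fps_X ^ ascents (A - A') (W - A' - (A - A')) = fps_X ^ ascents (A - A') (W - A)"
      by simp
  next
    fix S assume S: "S \<in> {S. S \<subseteq> W - A' \<and> card S = t - card A'}"
    then have fin: "finite S" using assms finite_subset by blast
    show "A' \<union> S - A' = S" using S by auto
    have "A' \<inter> S = {}" using S by auto
    then have "card (A' \<union> S) = t"
      using S fin fA assms by (simp add: card_Un_disjoint)
    then show "A' \<union> S \<in> {A. (A' \<subseteq> A \<and> A \<subseteq> W) \<and> card A = t}" using S assms by auto
  qed
  also have "\<dots> = gauss_poly (card (W - A')) (t - card A')"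
    using assms by (intro sum_subsets_ascents) auto
  finally show ?thesis using assms fA by (simp add: card_Diff_subset)
qed

text \<open>Lumping along \<open>card\<close>. As the sets \<open>R i\<close> decrease, each state
  that step i leaves is a subset of \<open>R i\<close>, which \<open>sum_set_step\<close> requires.
  The degree \<open>card A\<close> depends on the class only and so survives the lumping.\<close>

lemma chain_sum_sets:
  assumes fin: "\<And>i. finite (R i)"
    and mono: "\<And>i. 1 \<le> i \<Longrightarrow> R (Suc i) \<subseteq> R i"
    and card: "\<And>i. 1 \<le> i \<Longrightarrow> i \<le> l \<Longrightarrow> card (R i) = r i + s"
  shows "chain_sum (set_step R) (\<lambda>i A' A. monom (fps_X ^ set_exp R r i A' A) (card A)) l {} =
    chain_sum (num_step r s) (\<lambda>i c' c. monom (num_weight r s i c' c) c) l 0"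
proof -
  let ?w = "\<lambda>i A' A. monom (fps_X ^ set_exp R r i A' A) (card A) :: rat fps poly"
  let ?w' = "\<lambda>i c' c. monom (num_weight r s i c' c) c"
  have "chain_sum (set_step R) ?w l {} = chain_sum (num_step r s) ?w' l (card ({} :: nat set))"
  proof (rule chain_sum_lump[where R = "\<lambda>i. {A. A \<subseteq> R i}"])
    fix i A' assume i: "1 \<le> i" "i \<le> l" and A': "A' \<in> {A. A \<subseteq> R i}"
    show "card A \<in> num_step r s i (card A')" if "A \<in> set_step R i A'" for A
      using that A' fin[of i] card[OF i]
      by (auto simp: set_step_def num_step_def intro!: card_mono dest: finite_subset)
         (metis card_mono)
    fix t assume t: "t \<in> num_step r s i (card A')"
    have "(\<Sum>A | A \<in> set_step R i A' \<and> card A = t. ?w i A' A) =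
        (\<Sum>A | A \<in> set_step R i A' \<and> card A = t.
          monom (fps_X ^ quad (r i) t * fps_X ^ ascents (A - A') (R i - A)) t)"
      by (intro sum.cong) (auto simp: set_exp_def power_add)
    also have "\<dots> = ?w' i (card A') t"
      using sum_set_step[of "R i" A' t] A' fin card[OF i] t
      by (simp add: sum_monom num_weight_def set_step_def num_step_def flip: sum_distrib_left)
    finally show "(\<Sum>A | A \<in> set_step R i A' \<and> card A = t. ?w i A' A) = ?w' i (card A') t" .
  next
    fix i A' A assume i: "1 \<le> i" and A: "A \<in> set_step R (Suc i) A'"
    show "A \<in> {A. A \<subseteq> R i}" using A mono[OF i] by (auto simp: set_step_def)
  qed (use fin in \<open>auto simp: num_step_def intro: finite_set_step\<close>)
  then show ?thesis by simp
qed

section \<open>Pair chains and the q-Vandermonde identity\<close>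

definition pair_step :: "(nat \<Rightarrow> nat) \<Rightarrow> nat \<Rightarrow> nat \<Rightarrow> nat \<times> nat \<Rightarrow> (nat \<times> nat) set" where
  "pair_step r s i p' = {fst p'..r i} \<times> {snd p'..s}"

text \<open>
  The two ways of writing the exponent in the \<open>q\<close>-Vandermonde identity; the first is needed for
  \<open>b = 3 k + 1\<close>, the second for \<open>b = 3 k - 1\<close>.
\<close>

definition cross :: "bool \<Rightarrow> (nat \<Rightarrow> nat) \<Rightarrow> nat \<Rightarrow> nat \<Rightarrow> nat \<times> nat \<Rightarrow> nat \<times> nat \<Rightarrow> nat" where
  "cross d r s i p' p =
     (if d then (snd p - snd p') * (r i - fst p) else (fst p - fst p') * (s - snd p))"

definition pair_weight ::
    "bool \<Rightarrow> (nat \<Rightarrow> nat) \<Rightarrow> nat \<Rightarrow> nat \<Rightarrow> nat \<times> nat \<Rightarrow> nat \<times> nat \<Rightarrow> rat fps" where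
  "pair_weight d r s i p' p =
     fps_X ^ (quad (r i) (fst p + snd p) + cross d r s i p' p) *
     gauss_poly (r i - fst p') (fst p - fst p') * gauss_poly (s - snd p') (snd p - snd p')"

text \<open>This is \<open>gauss_poly_vandermonde\<close> for a - x' and b - z': on the line x + z =
  t a pair is determined by k = x - x', and the values k that leave the box contribute 0.\<close>

lemma vandermonde_pairs:
  assumes "x' \<le> a" "z' \<le> b" "x' + z' \<le> t"
  shows "(\<Sum>p | p \<in> {x'..a} \<times> {z'..b} \<and> fst p + snd p = t.
      fps_X ^ ((fst p - x') * (b - snd p)) * gauss_poly (a - x') (fst p - x') *
        gauss_poly (b - z') (snd p - z')) =
    gauss_poly (a + b - (x' + z')) (t - (x' + z'))"
proof -
  let ?n = "t - (x' + z')" let ?A = "a - x'" let ?B = "b - z'"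
  have "gauss_poly (a + b - (x' + z')) ?n = gauss_poly (?A + ?B) ?n"
    using assms by simp
  also have "\<dots> = (\<Sum>k\<le>?n. fps_X ^ (k * (?B - (?n - k))) * gauss_poly ?A k * gauss_poly ?B (?n - k))"
    by (rule gauss_poly_vandermonde)
  also have "\<dots> = (\<Sum>k | k \<le> ?n \<and> k \<le> ?A \<and> ?n - k \<le> ?B.
      fps_X ^ (k * (?B - (?n - k))) * gauss_poly ?A k * gauss_poly ?B (?n - k))"
    by (rule sum.mono_neutral_right) (auto dest: gauss_poly_nonzeroD)
  also have "\<dots> = (\<Sum>p | p \<in> {x'..a} \<times> {z'..b} \<and> fst p + snd p = t.
      fps_X ^ ((fst p - x') * (b - snd p)) * gauss_poly (a - x') (fst p - x') *
        gauss_poly (b - z') (snd p - z'))"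
  proof (rule sum.reindex_bij_witness[of _ "\<lambda>p. fst p - x'" "\<lambda>k. (x' + k, t - (x' + k))"])
    fix p assume "p \<in> {p. p \<in> {x'..a} \<times> {z'..b} \<and> fst p + snd p = t}"
    then obtain x z where p: "p = (x, z)" "x' \<le> x" "x \<le> a" "z' \<le> z" "z \<le> b" "x + z = t"
      by force
    then show "(x' + (fst p - x'), t - (x' + (fst p - x'))) = p"
      and "fst p - x' \<in> {k. k \<le> ?n \<and> k \<le> ?A \<and> ?n - k \<le> ?B}" by auto
  next
    fix k assume k: "k \<in> {k. k \<le> ?n \<and> k \<le> ?A \<and> ?n - k \<le> ?B}"
    then have "t - (x' + k) - z' = ?n - k" "b - (t - (x' + k)) = ?B - (?n - k)"
      using assms by auto
    then show "fps_X ^ ((fst (x' + k, t - (x' + k)) - x') * (b - snd (x' + k, t - (x' + k)))) *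
        gauss_poly (a - x') (fst (x' + k, t - (x' + k)) - x') *
        gauss_poly (b - z') (snd (x' + k, t - (x' + k)) - z') =
        fps_X ^ (k * (?B - (?n - k))) * gauss_poly ?A k * gauss_poly ?B (?n - k)"
      by simp
    show "(x' + k, t - (x' + k)) \<in> {p. p \<in> {x'..a} \<times> {z'..b} \<and> fst p + snd p = t}"
      using k assms by auto
  qed auto
  finally show ?thesis by simp
qed

lemma vandermonde_pairs_swap:
  assumes "x' \<le> a" "z' \<le> b" "x' + z' \<le> t"
  shows "(\<Sum>p | p \<in> {x'..a} \<times> {z'..b} \<and> fst p + snd p = t.
      fps_X ^ ((snd p - z') * (a - fst p)) * gauss_poly (a - x') (fst p - x') *
        gauss_poly (b - z') (snd p - z')) =
    gauss_poly (a + b - (x' + z')) (t - (x' + z'))"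
proof -
  have "(\<Sum>p | p \<in> {x'..a} \<times> {z'..b} \<and> fst p + snd p = t.
      fps_X ^ ((snd p - z') * (a - fst p)) * gauss_poly (a - x') (fst p - x') *
        gauss_poly (b - z') (snd p - z')) =
    (\<Sum>p | p \<in> {z'..b} \<times> {x'..a} \<and> fst p + snd p = t.
      fps_X ^ ((fst p - z') * (a - snd p)) * gauss_poly (b - z') (fst p - z') *
        gauss_poly (a - x') (snd p - x'))"
    by (rule sum.reindex_bij_witness[of _ prod.swap prod.swap]) (auto simp: mult_ac)
  also have "\<dots> = gauss_poly (b + a - (z' + x')) (t - (z' + x'))"
    using assms by (intro vandermonde_pairs) auto
  finally show ?thesis by (simp add: add.commute)
qed

text \<open>Lumping along x + z; the two forms of q-Vandermonde give the same weight for both values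
  of d. The box {0..r_i} x {0..s} supplies the bounds they require and is preserved because r
  decreases.\<close>

lemma chain_sum_pairs:
  assumes mono: "\<And>i. 1 \<le> i \<Longrightarrow> i < l \<Longrightarrow> r (Suc i) \<le> r i"
  shows "chain_sum (pair_step r s) (pair_weight d r s) l (0, 0) =
    chain_sum (num_step r s) (num_weight r s) l 0"
proof -
  have "chain_sum (pair_step r s) (pair_weight d r s) l (0, 0) =
    chain_sum (num_step r s) (num_weight r s) l ((\<lambda>p. fst p + snd p) (0, 0))"
  proof (rule chain_sum_lump[where R = "\<lambda>i. {..r i} \<times> {..s}"])
    fix i p' t assume p': "p' \<in> {..r i} \<times> {..s}" and t: "t \<in> num_step r s i (fst p' + snd p')"
    obtain x' z' where [simp]: "p' = (x', z')" by force
    let ?P = "{p. p \<in> pair_step r s i p' \<and> fst p + snd p = t}"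
    have "(\<Sum>p\<in>?P. pair_weight d r s i p' p) = (\<Sum>p\<in>?P. fps_X ^ quad (r i) t *
        (fps_X ^ cross d r s i p' p * gauss_poly (r i - x') (fst p - x') *
          gauss_poly (s - z') (snd p - z')))"
      by (intro sum.cong) (auto simp: pair_weight_def power_add mult_ac)
    also have "\<dots> = num_weight r s i (fst p' + snd p') t"
      unfolding cross_def
      using vandermonde_pairs[of x' "r i" z' s t] vandermonde_pairs_swap[of x' "r i" z' s t] p' t
      by (cases d) (simp_all add: pair_step_def num_step_def num_weight_def flip: sum_distrib_left)
    finally show "(\<Sum>p\<in>?P. pair_weight d r s i p' p) = num_weight r s i (fst p' + snd p') t" .
  next
    fix i p' p assume i: "1 \<le> i" "i < l" and p: "p \<in> pair_step r s (Suc i) p'"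
    show "p \<in> {..r i} \<times> {..s}"
      using p mono[OF i] by (auto simp: pair_step_def)
  qed (auto simp: pair_step_def num_step_def)
  then show ?thesis by simp
qed

section \<open>Tableaux as chains of column sets\<close>

definition row_tableaux :: "nat list \<Rightarrow> nat list list set" where
  "row_tableaux lam = {T. map length T = lam \<and> (\<forall>R\<in>set T. one_row_ssyt R)}"

definition ones :: "nat list list \<Rightarrow> nat \<Rightarrow> nat" where
  "ones T p = count_list (T ! p) 1"

text \<open>Columns are numbered from 1 here, unlike in \<open>inversions\<close>. Column 0 is empty
  by definition, since \<open>step_chains\<close> prescribes its default value there.\<close>

definition ones_col :: "nat list list \<Rightarrow> nat \<Rightarrow> nat set" where
  "ones_col T i = {p. p < length T \<and> 1 \<le> i \<and> i \<le> ones T p}"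

definition col :: "nat list \<Rightarrow> nat \<Rightarrow> nat set" where
  "col lam i = {p. p < length lam \<and> i \<le> lam ! p}"

lemma finite_col [simp]: "finite (col lam i)"
  by (simp add: col_def)

lemma finite_ones_col [simp]: "finite (ones_col T i)"
  by (simp add: ones_col_def)

lemma col_Suc_subset: "col lam (Suc i) \<subseteq> col lam i"
  by (auto simp: col_def)

lemma ones_col_Suc_subset: "1 \<le> i \<Longrightarrow> ones_col T (Suc i) \<subseteq> ones_col T i"
  by (auto simp: ones_col_def)

lemma one_row_ssyt_eq:
  "one_row_ssyt R \<Longrightarrow>
     R = replicate (count_list R 1) 1 @ replicate (length R - count_list R 1) 2"
proof (induction R)
  case (Cons x R)
  then have IH: "R = replicate (count_list R 1) 1 @ replicate (length R - count_list R 1) 2"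
    by (simp add: one_row_ssyt_def)
  show ?case
  proof (cases "x = 1")
    case False
    then have "x = 2" "1 \<notin> set R" using Cons.prems by (auto simp: one_row_ssyt_def)
    moreover from this have "R = replicate (length R) 2" using IH by simp
    ultimately show ?thesis by simp
  qed (use IH in simp)
qed simp

lemma count_list_replicate: "count_list (replicate n x) y = (if x = y then n else 0)"
  by (induction n) auto

lemma one_row_ssyt_replicate: "one_row_ssyt (replicate m 1 @ replicate n 2)"
  by (auto simp: one_row_ssyt_def sorted_append)

lemma
  assumes "T \<in> row_tableaux lam"
  shows length_row_tableaux: "length T = length lam"
    and length_row: "p < length lam \<Longrightarrow> length (T ! p) = lam ! p"
    and ones_le: "p < length lam \<Longrightarrow> ones T p \<le> lam ! p"
    and nth_row: "p < length lam \<Longrightarrow> i < lam ! p \<Longrightarrow> T ! p ! i = (if i < ones T p then 1 else 2)"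
    and row_eq: "p < length lam \<Longrightarrow>
        T ! p = replicate (ones T p) 1 @ replicate (lam ! p - ones T p) 2"
proof -
  show len: "length T = length lam"
    using assms by (auto simp: row_tableaux_def)
  assume p: "p < length lam"
  then have pT: "p < length T" by (simp add: len)
  show lenp: "length (T ! p) = lam ! p"
    using assms pT by (auto simp: row_tableaux_def)
  then show le: "ones T p \<le> lam ! p"
    using count_le_length[of "T ! p" 1] by (simp add: ones_def)
  have "one_row_ssyt (T ! p)"
    using assms pT by (auto simp: row_tableaux_def)
  from one_row_ssyt_eq[OF this]
  show eq: "T ! p = replicate (ones T p) 1 @ replicate (lam ! p - ones T p) 2"
    by (simp only: ones_def lenp)
  assume "i < lam ! p"
  then show "T ! p ! i = (if i < ones T p then 1 else 2)"
    by (subst eq) (simp add: nth_append)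
qed

lemma ones_col_subset_col: "T \<in> row_tableaux lam \<Longrightarrow> ones_col T i \<subseteq> col lam i"
  by (auto simp: ones_col_def col_def length_row_tableaux dest: ones_le)

lemma twos_col_eq:
  assumes "T \<in> row_tableaux lam" "1 \<le> i"
  shows "col lam i - ones_col T i = {p. p < length lam \<and> i \<le> lam ! p \<and> ones T p < i}"
  using assms by (auto simp: ones_col_def col_def length_row_tableaux)

lemma finite_row_tableaux: "finite (row_tableaux lam)"
proof (rule finite_subset)
  show "row_tableaux lam \<subseteq>
    {T. set T \<subseteq> {R. set R \<subseteq> {1, 2} \<and> length R \<le> sum_list lam} \<and> length T = length lam}"
  proof
    fix T assume T: "T \<in> row_tableaux lam"
    then have "set R \<subseteq> {1, 2} \<and> length R \<le> sum_list lam" if "R \<in> set T" for R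
      using that by (auto simp: row_tableaux_def one_row_ssyt_def intro!: member_le_sum_list)
    then show "T \<in> {T. set T \<subseteq> {R. set R \<subseteq> {1, 2} \<and> length R \<le> sum_list lam} \<and> length T = length lam}"
      using length_row_tableaux[OF T] by blast
  qed
  show "finite {T. set T \<subseteq> {R. set R \<subseteq> {1, 2::nat} \<and> length R \<le> sum_list lam} \<and> length T = length lam}"
    by (intro finite_lists_length_eq finite_lists_length_le) simp
qed

lemma tableaux_eq:
  "tableaux lam M = {T \<in> row_tableaux lam. sum_list (map (\<lambda>R. count_list R 1) T) = M}"
  by (auto simp: tableaux_def row_tableaux_def)

text \<open>Double counting of the entries 1, by rows and by columns.\<close>

lemma sum_ones_col:
  assumes T: "T \<in> row_tableaux lam" and l: "\<And>p. p < length lam \<Longrightarrow> lam ! p \<le> l"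
  shows "sum_list (map (\<lambda>R. count_list R 1) T) = (\<Sum>i=1..l. card (ones_col T i))"
proof -
  have "sum_list (map (\<lambda>R. count_list R 1) T) = (\<Sum>p<length T. ones T p)"
    by (simp add: sum_list_sum_nth ones_def atLeast0LessThan)
  also have "\<dots> = (\<Sum>p<length T. \<Sum>i=1..l. if i \<le> ones T p then 1 else 0)"
  proof (intro sum.cong refl)
    fix p assume "p \<in> {..<length T}"
    then have "ones T p \<le> l"
      using ones_le[OF T, of p] l[of p] length_row_tableaux[OF T] by simp
    then have "{1..l} \<inter> {i. i \<le> ones T p} = {1..ones T p}" by auto
    then show "ones T p = (\<Sum>i=1..l. if i \<le> ones T p then 1 else 0)"
      by (simp add: sum.If_cases)
  qed
  also have "\<dots> = (\<Sum>i=1..l. \<Sum>p<length T. if i \<le> ones T p then 1 else 0)"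
    by (rule sum.swap)
  also have "\<dots> = (\<Sum>i=1..l. card (ones_col T i))"
  proof (intro sum.cong refl)
    fix i assume "i \<in> {1..l}"
    then have "{..<length T} \<inter> {p. i \<le> ones T p} = ones_col T i" by (auto simp: ones_col_def)
    then show "(\<Sum>p<length T. if i \<le> ones T p then 1 else 0) = card (ones_col T i)"
      by (simp add: sum.If_cases)
  qed
  finally show ?thesis .
qed

lemma card_triples:
  assumes "\<And>i. i < l \<Longrightarrow> finite {(p, p'). P i p p'}"
  shows "card {(p::nat, p'::nat, i::nat). i < l \<and> P i p p'} = (\<Sum>i<l. card {(p, p'). P i p p'})"
proof -
  let ?f = "\<lambda>(i::nat, p::nat, p'::nat). (p, p', i)"
  have "{(p, p', i). i < l \<and> P i p p'} = ?f ` (SIGMA i:{..<l}. {(p, p'). P i p p'})"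
    by force
  moreover have "inj_on ?f (SIGMA i:{..<l}. {(p, p'). P i p p'})"
    by (auto simp: inj_on_def)
  ultimately have "card {(p, p', i). i < l \<and> P i p p'} = card (SIGMA i:{..<l}. {(p, p'). P i p p'})"
    by (simp add: card_image)
  also have "\<dots> = (\<Sum>i<l. card {(p, p'). P i p p'})"
    using assms by (subst card_SigmaI) auto
  finally show ?thesis .
qed

text \<open>
  A row with a 1 in column \<open>i + 1\<close> and a row with a 2 in column \<open>i\<close> form exactly one inversion,
  of the adjacent-column type if the former comes first and of the same-column type otherwise.
\<close>

lemma inversions_eq:
  assumes T: "T \<in> row_tableaux lam" and l: "\<And>p. p < length lam \<Longrightarrow> lam ! p \<le> l"
  shows "inversions T +
      (\<Sum>i=1..l. ascents (ones_col T i - ones_col T (Suc i)) (col lam i - ones_col T i)) =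
    (\<Sum>i=1..l. card (ones_col T i) * card (col lam i - ones_col T i))"
proof -
  define A where "A = ones_col T"
  define B where "B i = col lam i - A i" for i
  note len = length_row_tableaux[OF T]
  have fin: "finite (A i)" "finite (B i)" for i by (simp_all add: A_def B_def)
  have B: "p \<in> B (Suc i) \<longleftrightarrow> p < length lam \<and> Suc i \<le> lam ! p \<and> ones T p < Suc i" for p i
    using twos_col_eq[OF T, of "Suc i"] by (simp add: A_def B_def)
  have A: "p \<in> A (Suc i) \<longleftrightarrow> p < length lam \<and> Suc i \<le> lam ! p \<and> i < ones T p" for p i
    using ones_le[OF T, of p] by (auto simp: A_def ones_col_def len)
  have "{(p, p', i). p < p' \<and> p' < length T \<and> i < length (T ! p) \<and> i < length (T ! p') \<and>
           T ! p ! i = 2 \<and> T ! p' ! i = 1} =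
        {(p, p', i). i < l \<and> (p \<in> B (Suc i) \<and> p' \<in> A (Suc i) \<and> p < p')}"
  proof (intro Collect_cong, clarify, intro iffI conjI; elim conjE)
    fix p p' i
    assume *: "p < p'" "p' < length T" "i < length (T ! p)" "i < length (T ! p')"
      "T ! p ! i = 2" "T ! p' ! i = 1"
    then have p: "p < length lam" "p' < length lam" by (simp_all add: len)
    have i: "i < lam ! p" "i < lam ! p'" using * p by (simp_all add: length_row[OF T])
    show "i < l" using i(1) l[OF p(1)] by simp
    show "p \<in> B (Suc i)" "p' \<in> A (Suc i)"
      using * p i by (auto simp: A B nth_row[OF T] split: if_splits)
    show "p < p'" by fact
  next
    fix p p' i
    assume "p < p'" "p \<in> B (Suc i)" "p' \<in> A (Suc i)"
    then show "p < p'" "p' < length T" "i < length (T ! p)" "i < length (T ! p')"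
      "T ! p ! i = 2" "T ! p' ! i = 1"
      by (simp_all add: A B nth_row[OF T] length_row[OF T] len)
  qed
  then have 1: "card {(p, p', i). p < p' \<and> p' < length T \<and> i < length (T ! p) \<and>
      i < length (T ! p') \<and> T ! p ! i = 2 \<and> T ! p' ! i = 1} =
      (\<Sum>i<l. ascents (B (Suc i)) (A (Suc i)))"
    by (simp only:) (subst card_triples, auto simp: ascents_def intro: finite_ascents fin)
  have "{(p, p', i). p < p' \<and> p' < length T \<and> Suc i < length (T ! p) \<and> i < length (T ! p') \<and>
           T ! p ! Suc i = 1 \<and> T ! p' ! i = 2} =
        {(p, p', i). i < l \<and> (p \<in> A (Suc (Suc i)) \<and> p' \<in> B (Suc i) \<and> p < p')}"
  proof (intro Collect_cong, clarify, intro iffI conjI; elim conjE)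
    fix p p' i
    assume *: "p < p'" "p' < length T" "Suc i < length (T ! p)" "i < length (T ! p')"
      "T ! p ! Suc i = 1" "T ! p' ! i = 2"
    then have p: "p < length lam" "p' < length lam" by (simp_all add: len)
    have i: "Suc i < lam ! p" "i < lam ! p'" using * p by (simp_all add: length_row[OF T])
    show "i < l" using i(1) l[OF p(1)] by simp
    show "p \<in> A (Suc (Suc i))" "p' \<in> B (Suc i)"
      using * p i by (auto simp: A B nth_row[OF T] split: if_splits)
    show "p < p'" by fact
  next
    fix p p' i
    assume "p < p'" "p \<in> A (Suc (Suc i))" "p' \<in> B (Suc i)"
    then show "p < p'" "p' < length T" "Suc i < length (T ! p)" "i < length (T ! p')"
      "T ! p ! Suc i = 1" "T ! p' ! i = 2"
      by (simp_all add: A B nth_row[OF T] length_row[OF T] len)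
  qed
  then have 2: "card {(p, p', i). p < p' \<and> p' < length T \<and> Suc i < length (T ! p) \<and>
      i < length (T ! p') \<and> T ! p ! Suc i = 1 \<and> T ! p' ! i = 2} =
      (\<Sum>i<l. ascents (A (Suc (Suc i))) (B (Suc i)))"
    by (simp only:) (subst card_triples, auto simp: ascents_def intro: finite_ascents fin)
  \<comment> \<open>The rows with a 1 in a column are split according to whether the next column has
    a 1 too. Both kinds together give all ascents from 1s to 2s, and \<open>ascents_swap\<close>
    completes them to all pairs.\<close>
  have "ascents (B (Suc i)) (A (Suc i)) + ascents (A (Suc (Suc i))) (B (Suc i)) +
      ascents (A (Suc i) - A (Suc (Suc i))) (B (Suc i)) = card (A (Suc i)) * card (B (Suc i))" for i
  proof -
    have "A (Suc (Suc i)) \<union> (A (Suc i) - A (Suc (Suc i))) = A (Suc i)"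
      using ones_col_Suc_subset[of "Suc i" T] by (auto simp: A_def)
    then have "ascents (A (Suc (Suc i))) (B (Suc i)) +
        ascents (A (Suc i) - A (Suc (Suc i))) (B (Suc i)) = ascents (A (Suc i)) (B (Suc i))"
      using ascents_Un_left[of "A (Suc (Suc i))" "A (Suc i) - A (Suc (Suc i))" "B (Suc i)"] fin
      by simp
    moreover have "A (Suc i) \<inter> B (Suc i) = {}" by (auto simp: B_def)
    ultimately show ?thesis using ascents_swap[of "A (Suc i)" "B (Suc i)"] fin by simp
  qed
  then have "inversions T + (\<Sum>i<l. ascents (A (Suc i) - A (Suc (Suc i))) (B (Suc i))) =
      (\<Sum>i<l. card (A (Suc i)) * card (B (Suc i)))"
    unfolding inversions_def 1 2 by (simp flip: sum.distrib)
  moreover have "(\<Sum>i=1..l. f i) = (\<Sum>i<l. f (Suc i))" for f :: "nat \<Rightarrow> nat"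
    by (simp add: sum.atLeast1_atMost_eq)
  ultimately show ?thesis by (simp add: A_def B_def)
qed

text \<open>Either l + 1 is in D and downward closure fills {1..l+1}, or D already lies in {1..l}.
  It is applied to the columns in which a given row has a 1.\<close>

lemma down_closed_eq_interval:
  assumes "D \<subseteq> {1..l}" "\<And>i. 1 \<le> i \<Longrightarrow> Suc i \<in> D \<Longrightarrow> i \<in> D"
  shows "D = {1..card D}"
  using assms
proof (induction l arbitrary: D)
  case (Suc l)
  show ?case
  proof (cases "Suc l \<in> D")
    case True
    have "Suc l - n \<in> D" if "n \<le> l" for n
      using that
    proof (induction n)
      case (Suc n)
      then show ?case using \<open>\<And>i. 1 \<le> i \<Longrightarrow> Suc i \<in> D \<Longrightarrow> i \<in> D\<close>[of "Suc l - Suc n"]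
        by (simp add: Suc_diff_le)
    qed (use True in simp)
    then have "i \<in> D" if "i \<in> {1..Suc l}" for i
      using that by (metis Suc_diff_le atLeastAtMost_iff diff_diff_cancel diff_le_mono2 diff_Suc_1 One_nat_def)
    then have "D = {1..Suc l}" using Suc.prems by auto
    then show ?thesis by simp
  next
    case False
    then have "D \<subseteq> {1..l}" using Suc.prems(1) by (auto simp: subset_iff le_Suc_eq)
    then show ?thesis using Suc by blast
  qed
qed simp

text \<open>Since the sets f i are nested, the columns i with p in f i form an initial segment, and
  row p is recovered by writing that many 1s. The bound by \<open>col lam i\<close> says that they
  fit into the row.\<close>

lemma bij_betw_ones_col:
  assumes l: "\<And>p. p < length lam \<Longrightarrow> lam ! p \<le> l"
  shows "bij_betw ones_col (row_tableaux lam) (step_chains (set_step (col lam)) {} l {})"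
proof (rule bij_betw_byWitness[where f' =
    "\<lambda>f. map (\<lambda>p. let d = card {i \<in> {1..l}. p \<in> f i} in
              replicate d 1 @ replicate (lam ! p - d) 2) [0..<length lam]"])
  show "ones_col ` row_tableaux lam \<subseteq> step_chains (set_step (col lam)) {} l {}"
  proof clarify
    fix T assume T: "T \<in> row_tableaux lam"
    have "ones_col T i = {}" if "i \<notin> {1..l}" for i
      using that ones_le[OF T] l length_row_tableaux[OF T]
      by (auto simp: ones_col_def) (meson le_trans not_less_eq_eq)
    then show "ones_col T \<in> step_chains (set_step (col lam)) {} l {}"
      using ones_col_subset_col[OF T] ones_col_Suc_subset[of _ T]
      by (auto simp: step_chains_def set_step_def)
  qed
next
  show "\<forall>T\<in>row_tableaux lam. map (\<lambda>p. let d = card {i \<in> {1..l}. p \<in> ones_col T i} in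
      replicate d 1 @ replicate (lam ! p - d) 2) [0..<length lam] = T"
  proof
    fix T assume T: "T \<in> row_tableaux lam"
    have d: "card {i \<in> {1..l}. p \<in> ones_col T i} = ones T p" if "p < length lam" for p
    proof -
      have "{i \<in> {1..l}. p \<in> ones_col T i} = {1..ones T p}"
        using ones_le[OF T that] l[OF that] that length_row_tableaux[OF T]
        by (auto simp: ones_col_def)
      then show ?thesis by simp
    qed
    have "map (\<lambda>p. let d = card {i \<in> {1..l}. p \<in> ones_col T i} in
      replicate d 1 @ replicate (lam ! p - d) 2) [0..<length lam] = map ((!) T) [0..<length lam]"
      by (intro map_cong refl) (simp only: set_upt atLeastLessThan_iff d Let_def row_eq[OF T, symmetric])
    then show "map (\<lambda>p. let d = card {i \<in> {1..l}. p \<in> ones_col T i} in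
      replicate d 1 @ replicate (lam ! p - d) 2) [0..<length lam] = T"
      using map_nth[of T] by (simp only: length_row_tableaux[OF T])
  qed
next
  let ?T = "\<lambda>f :: nat \<Rightarrow> nat set. map (\<lambda>p. let d = card {i \<in> {1..l}. p \<in> f i} in
              replicate d 1 @ replicate (lam ! p - d) 2) [0..<length lam]"
  have *: "?T f \<in> row_tableaux lam \<and> ones_col (?T f) = f"
    if f: "f \<in> step_chains (set_step (col lam)) {} l {}" for f
  proof -
    define d where "d p = card {i \<in> {1..l}. p \<in> f i}" for p
    have step: "f (Suc i) \<subseteq> f i" "f i \<subseteq> col lam i" if "i \<in> {1..l}" for i
      using f that by (auto simp: step_chains_def set_step_def)
    have out: "f i = {}" if "i \<notin> {1..l}" for i
      using f that by (cases "i = Suc l") (auto simp: step_chains_def)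
    have D: "{i \<in> {1..l}. p \<in> f i} = {1..d p}" for p
      unfolding d_def
    proof (rule down_closed_eq_interval)
      fix i assume "1 \<le> i" "Suc i \<in> {i \<in> {1..l}. p \<in> f i}"
      then show "i \<in> {i \<in> {1..l}. p \<in> f i}" using step(1)[of i] by auto
    qed auto
    have le: "d p \<le> lam ! p" if "p < length lam" for p
    proof (cases "d p = 0")
      case False
      then have "d p \<in> {i \<in> {1..l}. p \<in> f i}" using D by simp
      then show ?thesis using step(2)[of "d p"] by (auto simp: col_def)
    qed simp
    define T :: "nat list list" where "T = ?T f"
    have Tf: "T = map (\<lambda>p. replicate (d p) 1 @ replicate (lam ! p - d p) (2 :: nat)) [0..<length lam]"
      by (simp only: T_def d_def Let_def)
    have "T \<in> row_tableaux lam"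
      using le unfolding row_tableaux_def Tf
      by (auto intro!: nth_equalityI one_row_ssyt_replicate[simplified])
    have ones: "ones T p = d p" if "p < length lam" for p
      using that unfolding Tf by (simp add: ones_def count_list_replicate)
    have len: "length T = length lam" by (simp add: Tf)
    have "ones_col T i = f i" for i
    proof -
      have "p \<in> f i \<longleftrightarrow> p < length lam \<and> 1 \<le> i \<and> i \<le> d p" for p
      proof
        assume p: "p \<in> f i"
        then have i: "i \<in> {1..l}" using out by auto
        then have "p < length lam" using p step(2)[of i] by (auto simp: col_def)
        moreover have "i \<in> {1..d p}" using D p i by blast
        ultimately show "p < length lam \<and> 1 \<le> i \<and> i \<le> d p" by simp
      next
        assume "p < length lam \<and> 1 \<le> i \<and> i \<le> d p"
        then have "i \<in> {1..d p}" by simp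
        then show "p \<in> f i" using D by blast
      qed
      then have "f i = {p. p < length lam \<and> 1 \<le> i \<and> i \<le> d p}" by (intro set_eqI) simp
      moreover have "ones_col T i = {p. p < length lam \<and> 1 \<le> i \<and> i \<le> d p}"
        unfolding ones_col_def len by (intro Collect_cong conj_cong refl) (simp only: ones)
      ultimately show ?thesis by simp
    qed
    then have "ones_col T = f" by (rule ext)
    with \<open>T \<in> row_tableaux lam\<close> show ?thesis unfolding T_def by (rule conjI)
  qed
  show "\<forall>f\<in>step_chains (set_step (col lam)) {} l {}. ones_col (?T f) = f"
    using * by blast
  show "?T ` step_chains (set_step (col lam)) {} l {} \<subseteq> row_tableaux lam"
    using * by blast
qed

lemma prod_monom: "(\<Prod>i\<in>A. monom (f i) (n i)) = monom (\<Prod>i\<in>A. f i) (\<Sum>i\<in>A. n i)"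
  by (induction A rule: infinite_finite_induct) (simp_all add: mult_monom)

text \<open>On the right the order of the rows has disappeared: only r, s and l are left. The degree
  records the number of 1s.\<close>

lemma sum_row_tableaux:
  assumes l: "\<And>p. p < length lam \<Longrightarrow> lam ! p \<le> l"
    and card: "\<And>i. 1 \<le> i \<Longrightarrow> i \<le> l \<Longrightarrow> card (col lam i) = r i + s"
  shows "(\<Sum>T\<in>row_tableaux lam.
      monom (fps_X ^ (\<Sum>i=1..l. set_exp (col lam) r i (ones_col T (Suc i)) (ones_col T i)))
        (sum_list (map (\<lambda>R. count_list R 1) T))) =
    chain_sum (num_step r s) (\<lambda>i c' c. monom (num_weight r s i c' c) c) l 0"
proof -
  have "(\<Sum>T\<in>row_tableaux lam.
      monom (fps_X ^ (\<Sum>i=1..l. set_exp (col lam) r i (ones_col T (Suc i)) (ones_col T i)))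
        (sum_list (map (\<lambda>R. count_list R 1) T))) =
    (\<Sum>T\<in>row_tableaux lam. \<Prod>i=1..l.
      monom (fps_X ^ set_exp (col lam) r i (ones_col T (Suc i)) (ones_col T i) :: rat fps)
        (card (ones_col T i)))"
    by (intro sum.cong refl) (simp only: prod_monom power_sum sum_ones_col[OF _ l])
  also have "\<dots> = (\<Sum>f\<in>step_chains (set_step (col lam)) {} l {}. \<Prod>i=1..l.
      monom (fps_X ^ set_exp (col lam) r i (f (Suc i)) (f i)) (card (f i)))"
    by (rule sum.reindex_bij_betw[OF bij_betw_ones_col[OF l]])
  also have "\<dots> = chain_sum (set_step (col lam))
      (\<lambda>i A' A. monom (fps_X ^ set_exp (col lam) r i A' A) (card A)) l {}"
    by (rule chain_sum_eq[symmetric]) (simp add: finite_set_step)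
  also have "\<dots> = chain_sum (num_step r s) (\<lambda>i c' c. monom (num_weight r s i c' c) c) l 0"
    using card by (intro chain_sum_sets col_Suc_subset) auto
  finally show ?thesis .
qed

section \<open>The gaps and the cone\<close>

text \<open>Treats both residues at once: e = 1 gives k = l and b = 3k + 1, while e = 2 gives k = l
  + 1 and b = 3k - 1.\<close>

locale gap_params =
  fixes b l e k :: nat
  assumes b_eq: "b = 3 * l + e" and e: "e = 1 \<or> e = 2" and l_pos: "1 \<le> l"
    and k_eq: "k = l + e - 1"
begin

lemma int_b: "int b = 3 * int l + int e"
  using b_eq by simp

lemma gaps_iff: "m \<in> gaps b \<longleftrightarrow> 0 \<le> m \<and> m \<notin> semigp b"
  using Ints_of_int[of m, where 'a = int] by (simp add: gaps_def Nats_altdef2)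

text \<open>Defined for all j, so that the shifts X j - 3 = X (j+1), Y j - 3 = Y (j+1) and Y j - b =
  X j stay available beyond the gaps, where lattice points of the cone are 0.\<close>

definition X :: "nat \<Rightarrow> int" where "X j = int b - 3 * int j"
definition Y :: "nat \<Rightarrow> int" where "Y j = 2 * int b - 3 * int j"

text \<open>0, b and 2b are the least elements of the semigroup in their classes modulo 3: as 3 does
  not divide b, the coefficient v of b cannot be 0 in the class of b, nor 0 or 1 in the class of
  2b.\<close>

lemma semigp_ge:
  shows "m \<in> semigp b \<Longrightarrow> m \<ge> 0"
    and "int b + 3 * t \<in> semigp b \<Longrightarrow> t \<ge> 0"
    and "2 * int b + 3 * t \<in> semigp b \<Longrightarrow> t \<ge> 0"
proof -
  show "m \<in> semigp b \<Longrightarrow> m \<ge> 0" by (auto simp: semigp_def)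
next
  assume "int b + 3 * t \<in> semigp b"
  then obtain u v where uv: "int b + 3 * t = 3 * int u + int b * int v"
    by (auto simp: semigp_def)
  have "v \<noteq> 0"
  proof
    assume "v = 0"
    then have "int b = 3 * (int u - t)" using uv by simp
    then show False using b_eq e by presburger
  qed
  then have "int b * 1 \<le> int b * int v" by (intro mult_left_mono) auto
  with uv show "t \<ge> 0" by linarith
next
  assume "2 * int b + 3 * t \<in> semigp b"
  then obtain u v where uv: "2 * int b + 3 * t = 3 * int u + int b * int v"
    by (auto simp: semigp_def)
  have "v \<noteq> 0"
  proof
    assume "v = 0"
    then have "2 * int b = 3 * (int u - t)" using uv by simp
    then show False using b_eq e by presburger
  qed
  moreover have "v \<noteq> 1"
  proof
    assume "v = 1"
    then have "int b = 3 * (int u - t)" using uv by simp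
    then show False using b_eq e by presburger
  qed
  ultimately have "int b * 2 \<le> int b * int v" by (intro mult_left_mono) auto
  with uv show "t \<ge> 0" by linarith
qed

lemma semigpI: "3 * int u + int b * int v \<in> semigp b"
  by (auto simp: semigp_def)

lemma X_in_gaps: "X j \<in> gaps b \<longleftrightarrow> j \<in> {1..l}"
proof
  assume "X j \<in> gaps b"
  then have g: "X j \<ge> 0" "X j \<notin> semigp b" by (auto simp: gaps_iff)
  have "j \<noteq> 0" using g(2) semigpI[of 0 1] by (cases "j = 0") (auto simp: X_def)
  moreover have "j \<le> l" using g(1) int_b e unfolding X_def by auto
  ultimately show "j \<in> {1..l}" by simp
next
  assume j: "j \<in> {1..l}"
  then have "X j \<ge> 0" using int_b unfolding X_def by auto
  moreover have "X j \<notin> semigp b"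
    using semigp_ge(2)[of "- int j"] j by (auto simp: X_def)
  ultimately show "X j \<in> gaps b" by (auto simp: gaps_iff)
qed

lemma Y_in_gaps: "Y j \<in> gaps b \<longleftrightarrow> j \<in> {1..l + k}"
proof
  assume "Y j \<in> gaps b"
  then have g: "Y j \<ge> 0" "Y j \<notin> semigp b" by (auto simp: gaps_iff)
  have "j \<noteq> 0" using g(2) semigpI[of 0 2] by (cases "j = 0") (auto simp: Y_def mult.commute)
  moreover have "j \<le> l + k" using g(1) int_b e k_eq unfolding Y_def by auto
  ultimately show "j \<in> {1..l + k}" by simp
next
  assume j: "j \<in> {1..l + k}"
  then have "Y j \<ge> 0" using int_b e k_eq unfolding Y_def by auto
  moreover have "Y j \<notin> semigp b"
    using semigp_ge(3)[of "- int j"] j by (auto simp: Y_def)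
  ultimately show "Y j \<in> gaps b" by (auto simp: gaps_iff)
qed

text \<open>Every integer is congruent to 0, b or 2b modulo 3. Nonnegative multiples of 3 are no
  gaps, and in the other classes the semigroup contains everything from b and 2b upwards.\<close>

lemma gaps_eq: "gaps b = X ` {1..l} \<union> Y ` {1..l + k}"
proof (intro equalityI subsetI)
  fix m assume m: "m \<in> gaps b"
  then have g: "m \<ge> 0" "m \<notin> semigp b" by (auto simp: gaps_iff)
  consider t where "m = 3 * t" | t where "m = int b - 3 * t" | t where "m = 2 * int b - 3 * t"
    using b_eq e by atomize_elim presburger
  then show "m \<in> X ` {1..l} \<union> Y ` {1..l + k}"
  proof cases
    case 1
    then have "m \<in> semigp b" using g(1) semigpI[of "nat t" 0] by simp
    with g show ?thesis by simp
  next
    case 2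
    have "t \<ge> 0"
      using g(2) semigpI[of "nat (- t)" 1] 2 by (cases "t \<ge> 0") auto
    then have "m = X (nat t)" using 2 by (simp add: X_def)
    then show ?thesis using m X_in_gaps by auto
  next
    case 3
    have "t \<ge> 0"
      using g(2) semigpI[of "nat (- t)" 2] 3 by (cases "t \<ge> 0") (auto simp: mult.commute)
    then have "m = Y (nat t)" using 3 by (simp add: Y_def)
    then show ?thesis using m Y_in_gaps by auto
  qed
next
  fix m assume "m \<in> X ` {1..l} \<union> Y ` {1..l + k}"
  then show "m \<in> gaps b" using X_in_gaps Y_in_gaps by auto
qed

lemma X_neq_Y: "X j \<noteq> Y m"
proof
  assume "X j = Y m"
  then have "int b = 3 * (int m - int j)" by (simp add: X_def Y_def)
  then show False using b_eq e by presburger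
qed

lemma inj_X: "inj_on X A" and inj_Y: "inj_on Y A"
  by (auto simp: inj_on_def X_def Y_def)

lemma sum_gaps: "(\<Sum>i\<in>gaps b. F i) = (\<Sum>j=1..l. F (X j)) + (\<Sum>j=1..l + k. F (Y j))"
  unfolding gaps_eq using X_neq_Y
  by (subst sum.union_disjoint) (auto simp: sum.reindex inj_X inj_Y)

lemma prod_gaps: "(\<Prod>i\<in>gaps b. F i) = (\<Prod>j=1..l. F (X j)) * (\<Prod>j=1..l + k. F (Y j))"
  unfolding gaps_eq using X_neq_Y
  by (subst prod.union_disjoint) (auto simp: prod.reindex inj_X inj_Y)

text \<open>The four indicators pair off into two windows of three consecutive integers. Each window
  meets every class modulo 3 exactly once, which makes \<open>U\<close> a combination of Kronecker
  deltas on differences of gaps.\<close>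

lemma U_eq: "U b d = of_bool (0 \<le> d \<and> d \<le> 2) - of_bool (int b \<le> d \<and> d \<le> int b + 2)"
  using b_eq l_pos by (auto simp: U_def of_bool_def)

lemma U_XX:
  assumes "j \<in> {1..l}" "m \<in> {1..l}"
  shows "U b (X m - X j) = of_bool (m = j)"
proof -
  have "X m - X j = 3 * (int j - int m)" by (simp add: X_def)
  moreover have "j \<le> l" "m \<ge> 1" using assms by auto
  moreover note int_b
  ultimately have "(0 \<le> X m - X j \<and> X m - X j \<le> 2) = (m = j)"
    "(int b \<le> X m - X j \<and> X m - X j \<le> int b + 2) = False"
    using e by presburger+
  then show ?thesis by (simp only: U_eq of_bool_eq diff_0_right)
qed

lemma U_YY:
  assumes "j \<in> {1..l + k}" "m \<in> {1..l + k}"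
  shows "U b (Y m - Y j) = of_bool (j = m) - of_bool (j = m + l + 1)"
proof -
  have "Y m - Y j = 3 * (int j - int m)" by (simp add: Y_def)
  moreover note int_b
  ultimately have "(0 \<le> Y m - Y j \<and> Y m - Y j \<le> 2) = (j = m)"
    "(int b \<le> Y m - Y j \<and> Y m - Y j \<le> int b + 2) = (j = m + l + 1)"
    using e by presburger+
  then show ?thesis by (simp only: U_eq)
qed

lemma U_XY:
  assumes "j \<in> {1..l}" "m \<in> {1..l + k}"
  shows "U b (Y m - X j) = of_bool (m = j + l) - of_bool (m = j)"
proof -
  have "Y m - X j = 3 * (int l + int j - int m) + int e"
    using int_b by (simp add: X_def Y_def)
  moreover note int_b
  ultimately have "(0 \<le> Y m - X j \<and> Y m - X j \<le> 2) = (m = j + l)"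
    "(int b \<le> Y m - X j \<and> Y m - X j \<le> int b + 2) = (m = j)"
    using e by presburger+
  then show ?thesis by (simp only: U_eq)
qed

lemma U_YX:
  assumes "j \<in> {1..l}" "m \<in> {1..l + k}"
  shows "U b (X j - Y m) = of_bool (m = j + l + 1)"
proof -
  have D: "X j - Y m = 3 * (int m - int l - int j) - int e"
    using int_b by (simp add: X_def Y_def)
  then have "(0 \<le> X j - Y m \<and> X j - Y m \<le> 2) = (m = j + l + 1)"
    using e by presburger
  \<comment> \<open>The ranges of the indices keep this difference below the second window.\<close>
  moreover have "int m \<le> 2 * int l + int e - 1" "1 \<le> int j" using assms k_eq e by auto
  then have "X j - Y m < int b"
    unfolding D using e int_b by auto
  ultimately show ?thesis by (simp add: U_eq)
qed

section \<open>The quadratic form and the cone in the coordinates x and y\<close>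

lemma sum_of_bool_eq:
  fixes g :: "'a \<Rightarrow> int"
  assumes "finite A" "c \<notin> A \<Longrightarrow> g c = 0"
  shows "(\<Sum>m\<in>A. of_bool (m = c) * a * g m) = a * g c"
proof -
  have "(\<Sum>m\<in>A. of_bool (m = c) * a * g m) = (\<Sum>m\<in>A. if m = c then a * g c else 0)"
    by (intro sum.cong) auto
  then show ?thesis using assms by simp
qed

text \<open>The deltas collapse the double sums. Where a delta points out of range, x and y are 0,
  so shifted indices need no case distinction.\<close>

lemma Q_eq:
  assumes n: "\<And>i. i \<notin> gaps b \<Longrightarrow> n i = 0"
  defines "x \<equiv> \<lambda>j. n (X j)" and "y \<equiv> \<lambda>j. n (Y j)"
  shows "Q b n = (\<Sum>j=1..l. x j ^ 2 - x j * y j + x j * (y (j + l) + y (j + l + 1))) +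
    (\<Sum>j=1..l + k. y j ^ 2 - y j * y (j + l + 1))"
proof -
  have x0: "j \<notin> {1..l} \<Longrightarrow> x j = 0" and y0: "j \<notin> {1..l + k} \<Longrightarrow> y j = 0" for j
    using n X_in_gaps Y_in_gaps by (auto simp: x_def y_def)
  have sx: "(\<Sum>m=1..l. of_bool (m = c) * a * x m) = a * x c" for a c
    by (rule sum_of_bool_eq) (use x0 in auto)
  have sy: "(\<Sum>m=1..l + k. of_bool (m = c) * a * y m) = a * y c" for a c
    by (rule sum_of_bool_eq) (use y0 in auto)
  have XX: "(\<Sum>m=1..l. U b (X m - X j) * x j * x m) = x j ^ 2" if "j \<in> {1..l}" for j
  proof -
    have "(\<Sum>m=1..l. U b (X m - X j) * x j * x m) = (\<Sum>m=1..l. of_bool (m = j) * x j * x m)"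
      using that by (intro sum.cong) (simp_all add: U_XX)
    then show ?thesis by (simp only: sx power2_eq_square)
  qed
  have XY: "(\<Sum>m=1..l + k. U b (Y m - X j) * x j * y m) = x j * y (j + l) - x j * y j"
    if "j \<in> {1..l}" for j
  proof -
    have "(\<Sum>m=1..l + k. U b (Y m - X j) * x j * y m) =
        (\<Sum>m=1..l + k. of_bool (m = j + l) * x j * y m - of_bool (m = j) * x j * y m)"
      using that by (intro sum.cong) (simp_all add: U_XY left_diff_distrib)
    then show ?thesis by (simp only: sum_subtractf sy)
  qed
  have YX: "(\<Sum>j=1..l + k. \<Sum>m=1..l. U b (X m - Y j) * y j * x m) = (\<Sum>j=1..l. x j * y (j + l + 1))"
  proof -
    have "(\<Sum>j=1..l + k. \<Sum>m=1..l. U b (X m - Y j) * y j * x m) =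
        (\<Sum>m=1..l. \<Sum>j=1..l + k. of_bool (j = m + l + 1) * x m * y j)"
      by (rule trans[OF sum.swap]) (intro sum.cong refl, simp add: U_YX)
    then show ?thesis by (simp only: sy)
  qed
  have YY: "(\<Sum>j=1..l + k. \<Sum>m=1..l + k. U b (Y m - Y j) * y j * y m) =
      (\<Sum>j=1..l + k. y j ^ 2 - y j * y (j + l + 1))"
  proof -
    have "(\<Sum>j=1..l + k. \<Sum>m=1..l + k. U b (Y m - Y j) * y j * y m) =
        (\<Sum>m=1..l + k. \<Sum>j=1..l + k. of_bool (j = m) * y m * y j - of_bool (j = m + l + 1) * y m * y j)"
      by (rule trans[OF sum.swap]) (intro sum.cong refl, simp add: U_YY left_diff_distrib mult_ac)
    then show ?thesis
      by (simp only: sum_subtractf sy power2_eq_square)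
  qed
  have "Q b n = (\<Sum>j=1..l. (\<Sum>m=1..l. U b (X m - X j) * x j * x m) +
        (\<Sum>m=1..l + k. U b (Y m - X j) * x j * y m)) +
      (\<Sum>j=1..l + k. (\<Sum>m=1..l. U b (X m - Y j) * y j * x m) +
        (\<Sum>m=1..l + k. U b (Y m - Y j) * y j * y m))"
    unfolding Q_def sum_gaps x_def y_def ..
  also have "\<dots> = (\<Sum>j=1..l. x j ^ 2 + (x j * y (j + l) - x j * y j)) +
      ((\<Sum>j=1..l. x j * y (j + l + 1)) + (\<Sum>j=1..l + k. y j ^ 2 - y j * y (j + l + 1)))"
    by (intro arg_cong2[where f = "(+)"] sum.cong refl)
       (simp_all only: XX XY sum.distrib YX YY)
  also have "\<dots> = (\<Sum>j=1..l. x j ^ 2 - x j * y j + x j * (y (j + l) + y (j + l + 1))) +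
    (\<Sum>j=1..l + k. y j ^ 2 - y j * y (j + l + 1))"
    by (simp add: algebra_simps sum.distrib sum_subtractf)
  finally show ?thesis .
qed

text \<open>The order is generated by the steps 3 and b, which lead from X j to X (j+1), from Y j to
  Y (j+1) and from Y j to X j. Where the smaller side is not indexed by a gap, it is 0.\<close>

lemma cone_points_iff:
  "n \<in> cone_points b \<longleftrightarrow> (\<forall>i. i \<notin> gaps b \<longrightarrow> n i = 0) \<and> (\<forall>i. n i \<ge> 0) \<and>
     (\<forall>j\<ge>1. n (X (Suc j)) \<le> n (X j) \<and> n (Y (Suc j)) \<le> n (Y j) \<and> n (X j) \<le> n (Y j))"
    (is "?L \<longleftrightarrow> ?R")
proof
  assume ?L
  then have out: "n i = 0" if "i \<notin> gaps b" for i using that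
    by (auto simp: cone_points_def cone_def)
  have nonneg: "n i \<ge> 0" for i
    using \<open>?L\<close> out[of i] by (cases "i \<in> gaps b") (auto simp: cone_points_def cone_def)
  have mono: "n j \<le> n i" if "i \<in> gaps b" "i - j \<in> semigp b" for i j
    using \<open>?L\<close> that out[of j] nonneg[of i]
    by (cases "j \<in> gaps b") (auto simp: cone_points_def cone_def)
  have "n (X (Suc j)) \<le> n (X j) \<and> n (Y (Suc j)) \<le> n (Y j) \<and> n (X j) \<le> n (Y j)"
    if j: "j \<ge> 1" for j
  proof (intro conjI)
    show "n (X (Suc j)) \<le> n (X j)"
    proof (cases "X j \<in> gaps b")
      case True
      then show ?thesis using semigpI[of 1 0] by (intro mono) (auto simp: X_def)
    next
      case False
      then show ?thesis using j out[of "X (Suc j)"] nonneg[of "X j"] X_in_gaps by auto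
    qed
    show "n (Y (Suc j)) \<le> n (Y j)"
    proof (cases "Y j \<in> gaps b")
      case True
      then show ?thesis using semigpI[of 1 0] by (intro mono) (auto simp: Y_def)
    next
      case False
      then show ?thesis using j out[of "Y (Suc j)"] nonneg[of "Y j"] Y_in_gaps by auto
    qed
    show "n (X j) \<le> n (Y j)"
    proof (cases "Y j \<in> gaps b")
      case True
      then show ?thesis using semigpI[of 0 1] by (intro mono) (auto simp: X_def Y_def)
    next
      case False
      then show ?thesis using j out[of "X j"] nonneg[of "Y j"] X_in_gaps Y_in_gaps by auto
    qed
  qed
  with out nonneg show ?R by blast
next
  assume R: ?R
  have xm: "n (X (j + d)) \<le> n (X j)" if "1 \<le> j" for j d
  proof (induction d)
    case (Suc d)
    have "n (X (Suc (j + d))) \<le> n (X (j + d))" using R that by simp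
    with Suc show ?case by simp
  qed simp
  have ym: "n (Y (j + d)) \<le> n (Y j)" if "1 \<le> j" for j d
  proof (induction d)
    case (Suc d)
    have "n (Y (Suc (j + d))) \<le> n (Y (j + d))" using R that by simp
    with Suc show ?case by simp
  qed simp
  have "n j \<le> n i" if ij: "i \<in> gaps b" "j \<in> gaps b" "i - j \<in> semigp b" for i j
  proof -
    from ij(1) consider a where "i = X a" "1 \<le> a" | a where "i = Y a" "1 \<le> a" "a \<le> l + k"
      unfolding gaps_eq by auto
    then show ?thesis
    proof cases
      case i: 1
      from ij(2) consider c where "j = X c" | c where "j = Y c" "c \<le> l + k"
        unfolding gaps_eq by auto
      then show ?thesis
      proof cases
        case j: 1
        have "a \<le> c" using semigp_ge(1)[OF ij(3)] i j by (simp add: X_def)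
        then show ?thesis using xm[of a "c - a"] i j by simp
      next
        case j: 2
        \<comment> \<open>Since -b is congruent to 2b modulo 3, \<open>semigp_ge\<close> would force
          c >= a + b, which exceeds the last index l + k.\<close>
        have "i - j = 2 * int b + 3 * (int c - int a - int b)"
          using i j by (simp add: X_def Y_def)
        then have "int c - int a - int b \<ge> 0" using semigp_ge(3) ij(3) by metis
        then show ?thesis using j i b_eq e k_eq by auto
      qed
    next
      case i: 2
      from ij(2) consider c where "j = X c" "1 \<le> c" | c where "j = Y c"
        unfolding gaps_eq by auto
      then show ?thesis
      proof cases
        case j: 1
        have "i - j = int b + 3 * (int c - int a)"
          using i j by (simp add: X_def Y_def)
        then have "int c - int a \<ge> 0" using semigp_ge(2) ij(3) by metis
        then have "n (Y c) \<le> n (Y a)" using ym[of a "c - a"] i by simp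
        moreover have "n (X c) \<le> n (Y c)" using R j by simp
        ultimately show ?thesis using i j by simp
      next
        case j: 2
        have "a \<le> c" using semigp_ge(1)[OF ij(3)] i j by (simp add: Y_def)
        then show ?thesis using ym[of a "c - a"] i j by simp
      qed
    qed
  qed
  then show ?L using R by (auto simp: cone_points_def cone_def)
qed

section \<open>Lattice points of the cone over a fixed sequence r\<close>

definition fibre :: "(nat \<Rightarrow> nat) \<Rightarrow> (int \<Rightarrow> int) set" where
  "fibre r = {n \<in> cone_points b. \<forall>j\<in>{1..k}. n (Y j) = int (r j)}"

text \<open>At i = 0 the second entry would be n (Y k), which is r_k on a fibre; (0, 0) is the
  default value of the chains instead.\<close>

definition pair_chain :: "(int \<Rightarrow> int) \<Rightarrow> nat \<Rightarrow> nat \<times> nat" where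
  "pair_chain n i = (if i = 0 then (0, 0) else (nat (n (X i)), nat (n (Y (k + i)))))"

text \<open>Inverse of \<open>pair_chain\<close> on the fibre: divisibility of b - i by 3 tells X j
  from Y j, and the quotient recovers j.\<close>

definition point :: "(nat \<Rightarrow> nat) \<Rightarrow> (nat \<Rightarrow> nat \<times> nat) \<Rightarrow> int \<Rightarrow> int" where
  "point r f i =
     (if i \<notin> gaps b then 0
      else if 3 dvd int b - i then int (fst (f (nat ((int b - i) div 3))))
      else let j = nat ((2 * int b - i) div 3) in
           if j \<le> k then int (r j) else int (snd (f (j - k))))"

lemma k_pos: "1 \<le> k" and l_le_k: "l \<le> k"
  using k_eq e l_pos by auto

lemma cone_pointsD:
  assumes "n \<in> cone_points b"
  shows "i \<notin> gaps b \<Longrightarrow> n i = 0" "n i \<ge> 0"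
    "1 \<le> j \<Longrightarrow> n (X (Suc j)) \<le> n (X j)" "1 \<le> j \<Longrightarrow> n (Y (Suc j)) \<le> n (Y j)"
    "1 \<le> j \<Longrightarrow> n (X j) \<le> n (Y j)"
    "j \<notin> {1..l} \<Longrightarrow> n (X j) = 0" "j \<notin> {1..l + k} \<Longrightarrow> n (Y j) = 0"
  using assms X_in_gaps[of j] Y_in_gaps[of j] unfolding cone_points_iff by blast+

lemma point_X: "point r f (X j) = (if j \<in> {1..l} then int (fst (f j)) else 0)"
  by (simp add: point_def X_in_gaps) (simp add: X_def)

lemma point_Y:
  "point r f (Y j) =
     (if j \<in> {1..k} then int (r j) else if j \<in> {Suc k..l + k} then int (snd (f (j - k))) else 0)"
proof -
  have "\<not> 3 dvd int b - Y j" using int_b e unfolding Y_def by presburger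
  then show ?thesis using Y_in_gaps[of j]
    by (auto simp: point_def Let_def) (auto simp: Y_def)
qed

lemma point_eqI:
  assumes "\<And>i. i \<notin> gaps b \<Longrightarrow> n i = 0" "\<And>i. i \<notin> gaps b \<Longrightarrow> n' i = 0"
    and "\<And>j. j \<in> {1..l} \<Longrightarrow> n (X j) = n' (X j)" "\<And>j. j \<in> {1..l + k} \<Longrightarrow> n (Y j) = n' (Y j)"
  shows "n = n'"
proof
  fix i
  show "n i = n' i" using assms by (cases "i \<in> gaps b") (auto simp: gaps_eq)
qed

text \<open>The bounds in \<open>pair_step\<close> are cone inequalities: x_i <= y_i = r_i because i
  <= l <= k, and z_i <= y_k = r_k because y decreases. Conversely, z_1 <= r_k is the inequality
  where r and z meet.\<close>

lemma bij_betw_pair_chain: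
  assumes r: "r \<in> row_seqs k"
  shows "bij_betw pair_chain (fibre r) (step_chains (pair_step r (r k)) (0, 0) l (0, 0))"
proof (rule bij_betw_byWitness[where f' = "point r"])
  show "\<forall>n\<in>fibre r. point r (pair_chain n) = n"
  proof
    fix n assume n: "n \<in> fibre r"
    then have nc: "n \<in> cone_points b" by (simp add: fibre_def)
    show "point r (pair_chain n) = n"
    proof (rule point_eqI)
      show "i \<notin> gaps b \<Longrightarrow> point r (pair_chain n) i = 0" for i by (simp add: point_def)
      show "i \<notin> gaps b \<Longrightarrow> n i = 0" for i by (rule cone_pointsD[OF nc])
      show "point r (pair_chain n) (X j) = n (X j)" if "j \<in> {1..l}" for j
        using that cone_pointsD(2)[OF nc] by (simp add: point_X pair_chain_def)
      show "point r (pair_chain n) (Y j) = n (Y j)" if "j \<in> {1..l + k}" for j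
        using that n cone_pointsD(2)[OF nc] by (auto simp: point_Y pair_chain_def fibre_def)
    qed
  qed
next
  show "\<forall>f\<in>step_chains (pair_step r (r k)) (0, 0) l (0, 0). pair_chain (point r f) = f"
  proof (intro ballI ext)
    fix f i assume f: "f \<in> step_chains (pair_step r (r k)) (0, 0) l (0, 0)"
    then have "f i = (0, 0)" if "i \<notin> {1..l}"
      using that by (cases "i = Suc l") (auto simp: step_chains_def)
    then show "pair_chain (point r f) i = f i"
      by (cases "i \<in> {1..l}") (auto simp: pair_chain_def point_X point_Y)
  qed
next
  show "pair_chain ` fibre r \<subseteq> step_chains (pair_step r (r k)) (0, 0) l (0, 0)"
  proof clarify
    fix n assume n: "n \<in> fibre r"
    then have nc: "n \<in> cone_points b" by (simp add: fibre_def)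
    have yr: "n (Y j) = int (r j)" if "j \<in> {1..k}" for j
      using n that by (auto simp: fibre_def)
    have "pair_chain n i = (0, 0)" if "i \<notin> {1..l}" for i
      using that cone_pointsD(6,7)[OF nc] by (auto simp: pair_chain_def)
    moreover have "pair_chain n i \<in> pair_step r (r k) i (pair_chain n (Suc i))" if i: "i \<in> {1..l}" for i
    proof -
      have "n (Y (k + j)) \<le> int (r k)" for j
      proof (induction j)
        case (Suc j)
        then show ?case using cone_pointsD(4)[OF nc, of "k + j"] k_pos by simp
      qed (use yr k_pos in simp)
      moreover have "n (X i) \<le> int (r i)"
        using cone_pointsD(5)[OF nc, of i] yr[of i] i l_le_k by simp
      ultimately show ?thesis
        using i cone_pointsD(3)[OF nc, of i] cone_pointsD(4)[OF nc, of "k + i"]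
        by (simp add: pair_step_def pair_chain_def nat_mono nat_le_iff)
    qed
    ultimately show "pair_chain n \<in> step_chains (pair_step r (r k)) (0, 0) l (0, 0)"
      by (auto simp: step_chains_def)
  qed
next
  show "point r ` step_chains (pair_step r (r k)) (0, 0) l (0, 0) \<subseteq> fibre r"
  proof clarify
    fix f assume f: "f \<in> step_chains (pair_step r (r k)) (0, 0) l (0, 0)"
    have out: "f i = (0, 0)" if "i \<notin> {1..l}" for i
      using f that by (cases "i = Suc l") (auto simp: step_chains_def)
    have step: "fst (f (Suc i)) \<le> fst (f i)" "fst (f i) \<le> r i"
      "snd (f (Suc i)) \<le> snd (f i)" "snd (f i) \<le> r k" if "i \<in> {1..l}" for i
    proof -
      have "f i \<in> pair_step r (r k) i (f (Suc i))" using f that by (auto simp: step_chains_def)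
      then show "fst (f (Suc i)) \<le> fst (f i)" "fst (f i) \<le> r i"
        "snd (f (Suc i)) \<le> snd (f i)" "snd (f i) \<le> r k" by (auto simp: pair_step_def)
    qed
    have rmono: "r (Suc j) \<le> r j" if "1 \<le> j" "Suc j \<le> k" for j
      using r that by (auto simp: row_seqs_def)
    have "point r f \<in> cone_points b"
      unfolding cone_points_iff
    proof (intro conjI allI impI)
      show "i \<notin> gaps b \<Longrightarrow> point r f i = 0" for i by (simp add: point_def)
      show "point r f i \<ge> 0" for i by (simp add: point_def Let_def)
      fix j :: nat assume j: "1 \<le> j"
      show "point r f (X (Suc j)) \<le> point r f (X j)"
        using j step(1)[of j] by (simp add: point_X)
      show "point r f (X j) \<le> point r f (Y j)"
        using j step(2)[of j] l_le_k by (simp add: point_X point_Y)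
      show "point r f (Y (Suc j)) \<le> point r f (Y j)"
      proof -
        consider "Suc j \<le> k" | "j = k" | "k < j" "j \<le> l + k" | "l + k < j" by linarith
        then show ?thesis
        proof cases
          case 3
          then have "Suc j - k = Suc (j - k)" "j - k \<in> {1..l}" by auto
          then show ?thesis using step(3)[of "j - k"] 3 j by (simp add: point_Y)
        qed (use j rmono[of j] step(4)[of 1] l_pos in \<open>simp_all add: point_Y\<close>)
      qed
    qed
    then show "point r f \<in> fibre r" by (simp add: fibre_def point_Y)
  qed
qed

section \<open>The quadratic form on a fibre\<close>

lemma sum_atLeast1_add:
  fixes f :: "nat \<Rightarrow> 'a::comm_monoid_add"
  shows "(\<Sum>j=1..a + c. f j) = (\<Sum>j=1..a. f j) + (\<Sum>j=1..c. f (a + j))"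
  by (induction c) (simp_all add: add.assoc)

lemma sum_telescope_int: "(\<Sum>j=1..m. h j - h (Suc j)) = h 1 - (h (Suc m) :: int)"
  by (induction m) simp_all

text \<open>For e = 1 the two forms agree summand by summand, for e = 2 up to a telescoping sum. The
  sum over {l+1..k} is empty or the single square r_k^2.\<close>

lemma Q_fibre:
  assumes n: "n \<in> fibre r"
  shows "Q b n = int ((\<Sum>j=1..l. quad (r j) (fst (pair_chain n j) + snd (pair_chain n j)) +
      cross (e = 1) r (r k) j (pair_chain n (Suc j)) (pair_chain n j)) + (\<Sum>j=Suc l..k. r j ^ 2))"
proof -
  have nc: "n \<in> cone_points b" using n by (simp add: fibre_def)
  note D = cone_pointsD[OF nc]
  define x where "x j = n (X j)" for j
  define y where "y j = n (Y j)" for j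
  define z where "z j = y (k + j)" for j
  define g where "g j = y j ^ 2 - y j * y (j + l + 1)" for j
  have yr: "y j = int (r j)" if "j \<in> {1..k}" for j
    using n that by (auto simp: fibre_def y_def)
  have y0: "y j = 0" if "l + k < j" for j using D(7)[of j] that by (simp add: y_def)
  have summand: "int (quad (r j) (fst (pair_chain n j) + snd (pair_chain n j)) +
      cross (e = 1) r (r k) j (pair_chain n (Suc j)) (pair_chain n j)) =
      (x j + z j) ^ 2 + y j ^ 2 - (x j + z j) * y j +
      (if e = 1 then (z j - z (Suc j)) * (y j - x j) else (x j - x (Suc j)) * (y k - z j))"
    if j: "j \<in> {1..l}" for j
  proof -
    have jk: "j \<in> {1..k}" using j l_le_k by auto
    have "z m \<le> int (r k)" for m
    proof (induction m)
      case (Suc m)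
      then show ?case using D(4)[of "k + m"] k_pos by (simp add: z_def y_def)
    qed (use yr k_pos in \<open>simp add: z_def\<close>)
    then have "nat (z j) \<le> r k" by (simp add: nat_le_iff)
    moreover have "nat (x j) \<le> r j"
      using D(5)[of j] yr[OF jk] j by (simp add: x_def y_def nat_le_iff)
    moreover have "nat (z (Suc j)) \<le> nat (z j)" "nat (x (Suc j)) \<le> nat (x j)"
      using D(3)[of j] D(4)[of "k + j"] j by (auto simp: x_def y_def z_def intro: nat_mono)
    moreover have "x j \<ge> 0" "x (Suc j) \<ge> 0" "z j \<ge> 0" "z (Suc j) \<ge> 0"
      using D(2) by (simp_all add: x_def y_def z_def)
    moreover have "pair_chain n j = (nat (x j), nat (z j))"
      "pair_chain n (Suc j) = (nat (x (Suc j)), nat (z (Suc j)))"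
      using j by (simp_all add: pair_chain_def x_def y_def z_def)
    moreover have "y k = int (r k)" using yr k_pos by simp
    ultimately show ?thesis using yr[OF jk]
      by (simp add: int_quad cross_def of_nat_diff)
  qed
  have "(\<Sum>j=1..l + k. g j) = (\<Sum>j=1..k. g j) + (\<Sum>j=1..l. g (k + j))"
    using sum_atLeast1_add[of g k l] by (simp add: add.commute)
  also have "(\<Sum>j=1..l. g (k + j)) = (\<Sum>j=1..l. z j ^ 2)"
    using y0 by (intro sum.cong) (auto simp: g_def z_def)
  also have "(\<Sum>j=1..k. g j) = (\<Sum>j=1..l. g j) + (\<Sum>j=Suc l..k. int (r j) ^ 2)"
  proof -
    have "(\<Sum>j=1..k. g j) = (\<Sum>j=1..l. g j) + (\<Sum>j=Suc l..k. g j)"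
      using sum.ub_add_nat[of 1 l g "k - l"] l_le_k by simp
    \<comment> \<open>As k <= l + 1, here j + l + 1 exceeds l + k and the mixed term is 0.\<close>
    moreover have "g j = int (r j) ^ 2" if "j \<in> {Suc l..k}" for j
      using that y0[of "j + l + 1"] yr[of j] k_eq e by (auto simp: g_def)
    ultimately show ?thesis by simp
  qed
  finally have gsum: "(\<Sum>j=1..l + k. g j) =
    (\<Sum>j=1..l. g j) + (\<Sum>j=Suc l..k. int (r j) ^ 2) + (\<Sum>j=1..l. z j ^ 2)" .
  have "Q b n = (\<Sum>j=1..l. x j ^ 2 - x j * y j + x j * (y (j + l) + y (j + l + 1)) + g j + z j ^ 2) +
      (\<Sum>j=Suc l..k. int (r j) ^ 2)"
    using Q_eq[of n] D(1) gsum by (simp add: x_def y_def g_def sum.distrib)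
  also have "(\<Sum>j=1..l. x j ^ 2 - x j * y j + x j * (y (j + l) + y (j + l + 1)) + g j + z j ^ 2) =
      (\<Sum>j=1..l. (x j + z j) ^ 2 + y j ^ 2 - (x j + z j) * y j +
      (if e = 1 then (z j - z (Suc j)) * (y j - x j) else (x j - x (Suc j)) * (y k - z j)))"
    using e
  proof
    assume e1: "e = 1"
    then have "y (j + l) = z j" "y (j + l + 1) = z (Suc j)" for j
      using k_eq by (simp_all add: z_def add.commute)
    then show ?thesis using e1
      by (intro sum.cong refl) (simp add: g_def power2_eq_square algebra_simps)
  next
    assume e2: "e = 2"
    \<comment> \<open>Now y (j + l) is z_{j-1}, or y_k for j = 1, so the two summands differ by h_j
      - h_{j+1}. Subtracting y_k makes h_1 vanish; h_{l+1} vanishes because x_{l+1} = 0.\<close>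
    define h where "h j = x j * (y (j + l) - y k)" for j
    have z: "y (j + l + 1) = z j" "y (Suc j + l) = z j" for j
      using k_eq e2 by (simp_all add: z_def add.commute)
    have "(\<Sum>j=1..l. x j ^ 2 - x j * y j + x j * (y (j + l) + y (j + l + 1)) + g j + z j ^ 2) =
      (\<Sum>j=1..l. ((x j + z j) ^ 2 + y j ^ 2 - (x j + z j) * y j +
        (x j - x (Suc j)) * (y k - z j)) + (h j - h (Suc j)))"
      unfolding h_def g_def z
      by (intro sum.cong refl) (simp add: power2_eq_square algebra_simps)
    also have "\<dots> = (\<Sum>j=1..l. (x j + z j) ^ 2 + y j ^ 2 - (x j + z j) * y j +
        (x j - x (Suc j)) * (y k - z j)) + (h 1 - h (Suc l))"
      by (simp only: sum.distrib sum_telescope_int)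
    also have "h 1 = 0" using k_eq e2 by (simp add: h_def)
    also have "h (Suc l) = 0" using D(6)[of "Suc l"] by (simp add: h_def x_def)
    finally show ?thesis using e2 by simp
  qed
  also have "\<dots> = (\<Sum>j=1..l. int (quad (r j) (fst (pair_chain n j) + snd (pair_chain n j)) +
      cross (e = 1) r (r k) j (pair_chain n (Suc j)) (pair_chain n j)))"
    using summand by (intro sum.cong) simp_all
  finally show ?thesis by simp
qed

end

section \<open>The product of q-factorials on a fibre\<close>

lemma prod_gauss_poly_row:
  assumes "1 \<le> k" "\<And>i. 1 \<le> i \<Longrightarrow> Suc i \<le> k \<Longrightarrow> r (Suc i) \<le> r i"
  shows "1 / qpoch (r 1) * (\<Prod>i=1..k-1. gauss_poly (r i) (r (i + 1))) =
    (\<Prod>i=1..k-1. inverse (qpoch (r i - r (Suc i)))) * inverse (qpoch (r k))"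
  using assms
proof (induction k rule: nat_induct_at_least)
  case base
  then show ?case using divide_qpoch[of 1 "r 1"] by simp
next
  case (Suc k)
  define P where "P = (\<Prod>i=1..k-1. inverse (qpoch (r i - r (Suc i))))"
  have split: "(\<Prod>i=1..k. f i) = (\<Prod>i=1..k-1. f i) * f k" for f :: "nat \<Rightarrow> rat fps"
    using Suc.hyps by (cases k) simp_all
  have "1 / qpoch (r 1) * (\<Prod>i=1..Suc k-1. gauss_poly (r i) (r (i + 1))) =
      (1 / qpoch (r 1) * (\<Prod>i=1..k-1. gauss_poly (r i) (r (i + 1)))) * gauss_poly (r k) (r (Suc k))"
    using split[of "\<lambda>i. gauss_poly (r i) (r (i + 1))"] by simp
  also have "\<dots> = P * inverse (qpoch (r k)) * gauss_poly (r k) (r (Suc k))"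
    using Suc by (simp add: P_def)
  \<comment> \<open>The numerator (q)_{r_k} of the new factor cancels the denominator left over by
    the earlier ones.\<close>
  also have "gauss_poly (r k) (r (Suc k)) =
      qpoch (r k) * inverse (qpoch (r (Suc k))) * inverse (qpoch (r k - r (Suc k)))"
    using Suc by (intro gauss_poly_eq) simp
  also have "P * inverse (qpoch (r k)) * \<dots> =
      P * inverse (qpoch (r k - r (Suc k))) * inverse (qpoch (r (Suc k))) *
        (qpoch (r k) * inverse (qpoch (r k)))"
    by (simp only: mult_ac)
  also have "\<dots> = (\<Prod>i=1..Suc k-1. inverse (qpoch (r i - r (Suc i)))) * inverse (qpoch (r (Suc k)))"
    using split[of "\<lambda>i. inverse (qpoch (r i - r (Suc i)))"] by (simp add: P_def)
  finally show ?case .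
qed

text \<open>The numerator (q)_{s - z_{j+1}} of factor j cancels a denominator of factor j + 1, so
  only the two ends remain.\<close>

lemma prod_gauss_poly_telescope:
  assumes "\<And>i. 1 \<le> i \<Longrightarrow> z (Suc i) \<le> z i" "z 1 \<le> s"
  shows "(\<Prod>j=1..l. gauss_poly (s - z (Suc j)) (z j - z (Suc j))) =
    (\<Prod>j=1..l. inverse (qpoch (z j - z (Suc j)))) * qpoch (s - z (Suc l)) * inverse (qpoch (s - z 1))"
proof (induction l)
  case (Suc l)
  define P where "P = (\<Prod>j=1..l. inverse (qpoch (z j - z (Suc j))))"
  have le: "z (Suc i) \<le> s" for i
    using assms(1)[of i] by (induction i) (use assms in \<open>auto intro: order_trans\<close>)
  have "gauss_poly (s - z (Suc (Suc l))) (z (Suc l) - z (Suc (Suc l))) =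
      qpoch (s - z (Suc (Suc l))) * inverse (qpoch (z (Suc l) - z (Suc (Suc l)))) *
        inverse (qpoch (s - z (Suc l)))"
    using le[of l] assms(1)[of "Suc l"] by (subst gauss_poly_eq) auto
  then have "(\<Prod>j=1..Suc l. gauss_poly (s - z (Suc j)) (z j - z (Suc j))) =
      P * inverse (qpoch (z (Suc l) - z (Suc (Suc l)))) * qpoch (s - z (Suc (Suc l))) *
        inverse (qpoch (s - z 1)) * (qpoch (s - z (Suc l)) * inverse (qpoch (s - z (Suc l))))"
    using Suc by (simp only: prod.cl_ivl_Suc P_def mult_ac) simp
  then show ?case by (simp add: P_def)
qed simp

context gap_params
begin

text \<open>The factors containing x form the first Gaussian polynomials. The factors 1/(q)_{y_j -
  y_{j+1}} split at j = k: those before it, divided by (q)_{r_k}, are the prefactor in r, and those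
  from it on, multiplied by (q)_{r_k}, form the Gaussian polynomials in z.\<close>

lemma prod_fibre:
  assumes n: "n \<in> fibre r" and r: "r \<in> row_seqs k"
  defines "x \<equiv> \<lambda>j. fst (pair_chain n j)" and "z \<equiv> \<lambda>j. snd (pair_chain n j)"
  shows "(\<Prod>i\<in>gaps b. qpoch (nat (n i - n (i - 3 - int b))) /
        (qpoch (nat (n i - n (i - 3))) * qpoch (nat (n i - n (i - int b))))) =
    (1 / qpoch (r 1) * (\<Prod>i=1..k-1. gauss_poly (r i) (r (i + 1)))) *
    (\<Prod>j=1..l. gauss_poly (r j - x (Suc j)) (x j - x (Suc j)) *
               gauss_poly (r k - z (Suc j)) (z j - z (Suc j)))"
proof -
  have nc: "n \<in> cone_points b" using n by (simp add: fibre_def)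
  note D = cone_pointsD[OF nc]
  define y where "y j = nat (n (Y j))" for j
  let ?I = "\<lambda>m. inverse (qpoch m)"
  have nat_sub: "nat (int a - int c) = a - c" for a c
    by arith
  have nX: "n (X j) = int (x j)" if "1 \<le> j" for j
    using that D(2) by (simp add: x_def pair_chain_def)
  have nY: "n (Y j) = int (y j)" for j using D(2) by (simp add: y_def)
  have yr: "y j = r j" if "j \<in> {1..k}" for j
    using n that by (auto simp: fibre_def y_def)
  have yz: "y (k + j) = z j" if "1 \<le> j" for j
    using that by (simp add: z_def pair_chain_def y_def)
  have x0: "x j = 0" if "l < j" for j using D(6)[of j] that nX[of j] by simp
  have z0: "z (Suc l) = 0" using D(7)[of "k + Suc l"] by (simp add: z_def pair_chain_def)
  have xmono: "x (Suc j) \<le> x j" and ymono: "y (Suc j) \<le> y j" and xy: "x j \<le> y j"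
    if "1 \<le> j" for j
    using D(3,4,5)[OF that] nX[of j] nX[of "Suc j"] nY that by simp_all
  have zmono: "z (Suc j) \<le> z j" if "1 \<le> j" for j
    using ymono[of "k + j"] yz[of j] yz[of "Suc j"] that by simp
  have z1: "z 1 \<le> r k" using ymono[of k] yz[of 1] yr[of k] k_pos by simp
  have X: "qpoch (nat (n (X j) - n (X j - 3 - int b))) /
      (qpoch (nat (n (X j) - n (X j - 3))) * qpoch (nat (n (X j) - n (X j - int b)))) =
      ?I (x j - x (Suc j))" if j: "j \<in> {1..l}" for j
  proof -
    \<comment> \<open>X j - b = -3j is negative, hence no gap; the numerator then cancels one of the
      denominators.\<close>
    have "n (X j - 3 - int b) = 0" "n (X j - int b) = 0"
      using j by (intro D(1), simp add: gaps_iff X_def)+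
    moreover have "X j - 3 = X (Suc j)" by (simp add: X_def)
    ultimately have "qpoch (nat (n (X j) - n (X j - 3 - int b))) /
      (qpoch (nat (n (X j) - n (X j - 3))) * qpoch (nat (n (X j) - n (X j - int b)))) =
      qpoch (x j) * ?I (x j - x (Suc j)) * ?I (x j)"
      using j nX[of j] nX[of "Suc j"] by (simp add: divide_qpoch2 nat_sub)
    also have "\<dots> = ?I (x j - x (Suc j)) * (qpoch (x j) * ?I (x j))" by (simp only: mult_ac)
    finally show ?thesis by simp
  qed
  have Y: "qpoch (nat (n (Y j) - n (Y j - 3 - int b))) /
      (qpoch (nat (n (Y j) - n (Y j - 3))) * qpoch (nat (n (Y j) - n (Y j - int b)))) =
      qpoch (y j - x (Suc j)) * ?I (y j - x j) * ?I (y j - y (Suc j))" if j: "1 \<le> j" for j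
  proof -
    have "Y j - 3 - int b = X (Suc j)" "Y j - 3 = Y (Suc j)" "Y j - int b = X j"
      by (simp_all add: X_def Y_def)
    then show ?thesis
      using j nX[of j] nX[of "Suc j"] nY
      by (simp add: divide_qpoch2 nat_sub mult_ac)
  qed
  have split: "(\<Prod>j=1..a + c. f j) = (\<Prod>j=1..a. f j) * (\<Prod>j=1..c. f (a + j))"
    for a c and f :: "nat \<Rightarrow> rat fps"
    by (induction c) (simp_all add: mult.assoc)
  have "(\<Prod>i\<in>gaps b. qpoch (nat (n i - n (i - 3 - int b))) /
        (qpoch (nat (n i - n (i - 3))) * qpoch (nat (n i - n (i - int b))))) =
      (\<Prod>j=1..l. ?I (x j - x (Suc j))) *
      (\<Prod>j=1..l + k. qpoch (y j - x (Suc j)) * ?I (y j - x j) * ?I (y j - y (Suc j)))"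
    unfolding prod_gaps by (intro arg_cong2[where f = "(*)"] prod.cong refl) (simp_all add: X Y)
  also have "\<dots> = (\<Prod>j=1..l. ?I (x j - x (Suc j))) *
      (\<Prod>j=1..l + k. qpoch (y j - x (Suc j)) * ?I (y j - x j)) *
      (\<Prod>j=1..k + l. ?I (y j - y (Suc j)))"
    by (simp only: prod.distrib mult.assoc add.commute)
  \<comment> \<open>For j > l both entries of x are 0 and the factor is 1.\<close>
  also have "(\<Prod>j=1..l + k. qpoch (y j - x (Suc j)) * ?I (y j - x j)) =
      (\<Prod>j=1..l. qpoch (y j - x (Suc j)) * ?I (y j - x j))"
    unfolding split by (simp add: x0)
  also have "(\<Prod>j=1..l. ?I (x j - x (Suc j))) * \<dots> =
      (\<Prod>j=1..l. gauss_poly (r j - x (Suc j)) (x j - x (Suc j)))"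
    unfolding prod.distrib[symmetric]
  proof (intro prod.cong refl)
    fix j assume j: "j \<in> {1..l}"
    then have "y j = r j" using yr[of j] l_le_k by simp
    then show "?I (x j - x (Suc j)) * (qpoch (y j - x (Suc j)) * ?I (y j - x j)) =
        gauss_poly (r j - x (Suc j)) (x j - x (Suc j))"
      using j xmono[of j] xy[of j] by (subst gauss_poly_eq) (simp_all add: mult_ac)
  qed
  also have "(\<Prod>j=1..k + l. ?I (y j - y (Suc j))) =
      (\<Prod>j=1..k-1. ?I (r j - r (Suc j))) * ?I (r k - z 1) * (\<Prod>j=1..l. ?I (z j - z (Suc j)))"
  proof -
    have "(\<Prod>j=1..k. ?I (y j - y (Suc j))) = (\<Prod>j=1..k-1. ?I (y j - y (Suc j))) * ?I (y k - y (Suc k))"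
      using split[of "\<lambda>j. ?I (y j - y (Suc j))" "k - 1" 1] k_pos by simp
    also have "(\<Prod>j=1..k-1. ?I (y j - y (Suc j))) = (\<Prod>j=1..k-1. ?I (r j - r (Suc j)))"
      by (intro prod.cong refl) (auto simp: yr)
    also have "y k - y (Suc k) = r k - z 1" using yr[of k] yz[of 1] k_pos by simp
    finally have 1: "(\<Prod>j=1..k. ?I (y j - y (Suc j))) =
        (\<Prod>j=1..k-1. ?I (r j - r (Suc j))) * ?I (r k - z 1)" .
    have "(\<Prod>j=1..l. ?I (y (k + j) - y (Suc (k + j)))) = (\<Prod>j=1..l. ?I (z j - z (Suc j)))"
      using yz[of "Suc _"] by (intro prod.cong refl) (simp add: yz)
    then show ?thesis unfolding split 1 by simp
  qed
  also have "\<dots> = (1 / qpoch (r 1) * (\<Prod>i=1..k-1. gauss_poly (r i) (r (i + 1)))) *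
      (\<Prod>j=1..l. gauss_poly (r k - z (Suc j)) (z j - z (Suc j)))"
  proof -
    let ?A = "\<Prod>j=1..k-1. ?I (r j - r (Suc j))" and ?B = "\<Prod>j=1..l. ?I (z j - z (Suc j))"
    have "1 / qpoch (r 1) * (\<Prod>i=1..k-1. gauss_poly (r i) (r (i + 1))) = ?A * ?I (r k)"
      using r k_pos by (intro prod_gauss_poly_row) (auto simp: row_seqs_def)
    moreover have "(\<Prod>j=1..l. gauss_poly (r k - z (Suc j)) (z j - z (Suc j))) =
        ?B * qpoch (r k) * ?I (r k - z 1)"
      using prod_gauss_poly_telescope[of z "r k" l] zmono z1 z0 by simp
    ultimately have "(1 / qpoch (r 1) * (\<Prod>i=1..k-1. gauss_poly (r i) (r (i + 1)))) *
      (\<Prod>j=1..l. gauss_poly (r k - z (Suc j)) (z j - z (Suc j))) =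
        ?A * ?I (r k - z 1) * ?B * (qpoch (r k) * ?I (r k))"
      by (simp only: mult_ac)
    then show ?thesis by simp
  qed
  finally show ?thesis by (simp only: prod.distrib mult_ac)
qed

lemma Z_term_fibre:
  assumes n: "n \<in> fibre r" and r: "r \<in> row_seqs k"
  shows "Z_term b n =
    fps_X ^ (\<Sum>j=Suc l..k. r j ^ 2) *
    (1 / qpoch (r 1) * (\<Prod>i=1..k-1. gauss_poly (r i) (r (i + 1)))) *
    (\<Prod>j=1..l. pair_weight (e = 1) r (r k) j (pair_chain n (Suc j)) (pair_chain n j))"
proof -
  have "nat (Q b n) = (\<Sum>j=1..l. quad (r j) (fst (pair_chain n j) + snd (pair_chain n j)) +
      cross (e = 1) r (r k) j (pair_chain n (Suc j)) (pair_chain n j)) + (\<Sum>j=Suc l..k. r j ^ 2)"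
    unfolding Q_fibre[OF n] by (rule nat_int)
  then show ?thesis
    unfolding Z_term_def prod_fibre[OF n r] pair_weight_def
    by (simp only: power_add power_sum prod.distrib mult_ac)
qed

text \<open>The chain sum on the right is the one that \<open>infsum_tableau_sum\<close> finds for
  the tableaux.\<close>

lemma sum_Z_term_fibre:
  assumes r: "r \<in> row_seqs k"
  shows "(\<Sum>n\<in>fibre r. Z_term b n) =
    fps_X ^ (\<Sum>j=Suc l..k. r j ^ 2) *
    (1 / qpoch (r 1) * (\<Prod>i=1..k-1. gauss_poly (r i) (r (i + 1)))) *
    chain_sum (num_step r (r k)) (num_weight r (r k)) l 0"
proof -
  let ?c = "fps_X ^ (\<Sum>j=Suc l..k. r j ^ 2) *
    (1 / qpoch (r 1) * (\<Prod>i=1..k-1. gauss_poly (r i) (r (i + 1))))"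
  have "(\<Sum>n\<in>fibre r. Z_term b n) = (\<Sum>n\<in>fibre r. ?c *
      (\<Prod>j=1..l. pair_weight (e = 1) r (r k) j (pair_chain n (Suc j)) (pair_chain n j)))"
    using Z_term_fibre[OF _ r] by (intro sum.cong) auto
  also have "\<dots> = (\<Sum>f\<in>step_chains (pair_step r (r k)) (0, 0) l (0, 0). ?c *
      (\<Prod>j=1..l. pair_weight (e = 1) r (r k) j (f (Suc j)) (f j)))"
    by (rule sum.reindex_bij_betw[OF bij_betw_pair_chain[OF r]])
  also have "\<dots> = ?c * chain_sum (pair_step r (r k)) (pair_weight (e = 1) r (r k)) l (0, 0)"
    by (subst chain_sum_eq[where ?u0.0 = "(0, 0)"])
       (simp_all add: pair_step_def sum_distrib_left)
  also have "chain_sum (pair_step r (r k)) (pair_weight (e = 1) r (r k)) l (0, 0) =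
      chain_sum (num_step r (r k)) (num_weight r (r k)) l 0"
    using r l_le_k by (intro chain_sum_pairs) (auto simp: row_seqs_def)
  finally show ?thesis .
qed

lemma finite_fibre: "r \<in> row_seqs k \<Longrightarrow> finite (fibre r)"
  using bij_betw_finite[OF bij_betw_pair_chain]
  by (simp add: finite_step_chains pair_step_def)

end

section \<open>Summation over the fibres\<close>

text \<open>Each coefficient involves only finitely many a, namely some in finitely many finite
  fibres. So the sum is built coefficient by coefficient, and finite sums are regrouped along
  \<pi>.\<close>

lemma fps_has_sum_fibres:
  fixes f :: "'a \<Rightarrow> 'c::ab_group_add fps" and g :: "'b \<Rightarrow> 'c fps"
  assumes maps: "\<And>a. a \<in> A \<Longrightarrow> \<pi> a \<in> B"
    and fin: "\<And>b. b \<in> B \<Longrightarrow> finite {a \<in> A. \<pi> a = b}"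
    and finN: "\<And>N. finite {b \<in> B. \<exists>a\<in>A. \<pi> a = b \<and> fps_nth (f a) N \<noteq> 0}"
    and g: "\<And>b. b \<in> B \<Longrightarrow> g b = (\<Sum>a | a \<in> A \<and> \<pi> a = b. f a)"
  shows "f summable_on A" and "(g has_sum infsum f A) B"
proof -
  define AN where "AN N = {a \<in> A. fps_nth (f a) N \<noteq> 0}" for N
  define BN where "BN N = {b \<in> B. \<exists>a\<in>A. \<pi> a = b \<and> fps_nth (f a) N \<noteq> 0}" for N
  define S where "S = Abs_fps (\<lambda>N. \<Sum>a\<in>AN N. fps_nth (f a) N)"
  have finBN: "finite (BN N)" for N using finN by (simp add: BN_def)
  have finAN: "finite (AN N)" for N
  proof (rule finite_subset)
    show "AN N \<subseteq> (\<Union>b\<in>BN N. {a \<in> A. \<pi> a = b})" using maps by (auto simp: AN_def BN_def)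
    show "finite (\<Union>b\<in>BN N. {a \<in> A. \<pi> a = b})" using finBN fin by (auto simp: BN_def)
  qed
  have f: "(f has_sum S) A"
    by (rule has_sum_fpsI) (use finAN in \<open>auto simp: AN_def S_def\<close>)
  then show "f summable_on A" by (rule has_sum_imp_summable)
  have gN: "fps_nth (g b) N = (\<Sum>a | a \<in> AN N \<and> \<pi> a = b. fps_nth (f a) N)" if "b \<in> B" for b N
    unfolding g[OF that] fps_sum_nth
    by (rule sum.mono_neutral_right) (use fin[OF that] in \<open>auto simp: AN_def\<close>)
  have sub: "{b \<in> B. fps_nth (g b) N \<noteq> 0} \<subseteq> BN N" for N
  proof clarify
    fix b assume b: "b \<in> B" "fps_nth (g b) N \<noteq> 0"
    then obtain a where "a \<in> AN N" "\<pi> a = b"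
      using gN[OF b(1)] by (metis (mono_tags, lifting) mem_Collect_eq sum.neutral)
    then show "b \<in> BN N" using b by (auto simp: AN_def BN_def)
  qed
  have "(g has_sum S) B"
  proof (rule has_sum_fpsI)
    fix N
    show "finite {b \<in> B. fps_nth (g b) N \<noteq> 0}" using sub finBN finite_subset by blast
    have "fps_nth S N = (\<Sum>a\<in>AN N. fps_nth (f a) N)" by (simp add: S_def)
    also have "\<dots> = (\<Sum>b\<in>BN N. \<Sum>a | a \<in> AN N \<and> \<pi> a = b. fps_nth (f a) N)"
      by (rule sum.group[symmetric]) (use finAN finBN maps in \<open>auto simp: AN_def BN_def\<close>)
    also have "\<dots> = (\<Sum>b\<in>BN N. fps_nth (g b) N)"
      by (intro sum.cong refl gN[symmetric]) (simp add: BN_def)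
    also have "\<dots> = (\<Sum>b | b \<in> B \<and> fps_nth (g b) N \<noteq> 0. fps_nth (g b) N)"
      by (rule sum.mono_neutral_right) (use finBN sub in \<open>auto simp: BN_def\<close>)
    finally show "fps_nth S N = (\<Sum>b | b \<in> B \<and> fps_nth (g b) N \<noteq> 0. fps_nth (g b) N)" .
  qed
  then show "(g has_sum infsum f A) B" using infsumI[OF f] by simp
qed

text \<open>With c = n - a, the bounds a <= a^2 and c <= c^2 give 2ac <= (a + c)^2 - (a + c).
  Applied column by column, it yields the nonnegativity of \<open>coinv\<close>.\<close>

lemma mult_diff_le_choose_two: "a \<le> n \<Longrightarrow> a * (n - a) \<le> n choose 2"
proof -
  assume "a \<le> n"
  then obtain c where n: "n = a + c" using le_Suc_ex by blast
  have "2 * (a * c) \<le> (a + c) * (a + c - 1)"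
  proof (cases "a + c")
    case (Suc m)
    have "a \<le> a * a" "c \<le> c * c" by (cases a; simp) (cases c; simp)
    moreover have "(a + c) * (a + c) = 2 * (a * c) + (a * a + c * c)" by (simp add: algebra_simps)
    ultimately have "2 * (a * c) + (a + c) \<le> (a + c) * (a + c)" by linarith
    also have "\<dots> = (a + c) * (a + c - 1) + (a + c)" by (simp add: Suc)
    finally show ?thesis by simp
  qed simp
  then show ?thesis by (simp add: n choose_two)
qed

text \<open>4 \<open>quad r c\<close> = (2c - r)^2 + 3 r^2. The bound lets only finitely many r
  contribute to a given power of q.\<close>

lemma le_4_quad: "r \<le> 4 * quad r c"
proof -
  have "3 * int r ^ 2 \<le> (2 * int c - int r) ^ 2 + 3 * int r ^ 2" by simp
  also have "\<dots> = 4 * int (quad r c)"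
    by (simp add: int_quad power2_eq_square algebra_simps)
  finally have "int (3 * r ^ 2) \<le> int (4 * quad r c)" by simp
  then have "3 * r ^ 2 \<le> 4 * quad r c" by (simp only: of_nat_le_iff)
  moreover have "r \<le> r ^ 2" by (cases r) (simp_all add: power2_eq_square)
  ultimately show ?thesis by linarith
qed

text \<open>With the 1s first only adjacent columns give inversions, and there are m - 1 such pairs
  of columns; with the 2s first each of the m columns gives one.\<close>

lemma inversions_two_rows:
  "inversions [replicate m 1, replicate m 2] = m - 1" "inversions [replicate m 2, replicate m 1] = m"
proof -
  let ?f = "\<lambda>i::nat. (0::nat, 1::nat, i)"
  have card: "card (?f ` {..<n}) = n" for n
    by (simp add: card_image inj_on_def)
  define T1 where "T1 = [replicate m 1, replicate m (2::nat)]"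
  define T2 where "T2 = [replicate m 2, replicate m (1::nat)]"
  have "{(p, p', i). p < p' \<and> p' < length T1 \<and> i < length (T1 ! p) \<and> i < length (T1 ! p') \<and>
      T1 ! p ! i = 2 \<and> T1 ! p' ! i = 1} = {}"
    by (auto simp: T1_def less_Suc_eq)
  moreover have "{(p, p', i). p < p' \<and> p' < length T1 \<and> Suc i < length (T1 ! p) \<and>
      i < length (T1 ! p') \<and> T1 ! p ! Suc i = 1 \<and> T1 ! p' ! i = 2} = ?f ` {..<m - 1}"
    by (auto simp: T1_def less_Suc_eq image_iff)
  ultimately show "inversions [replicate m 1, replicate m 2] = m - 1"
    unfolding inversions_def T1_def[symmetric] by (simp only: card card.empty add_0)
  have "{(p, p', i). p < p' \<and> p' < length T2 \<and> i < length (T2 ! p) \<and> i < length (T2 ! p') \<and>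
      T2 ! p ! i = 2 \<and> T2 ! p' ! i = 1} = ?f ` {..<m}"
    by (auto simp: T2_def less_Suc_eq image_iff)
  moreover have "{(p, p', i). p < p' \<and> p' < length T2 \<and> Suc i < length (T2 ! p) \<and>
      i < length (T2 ! p') \<and> T2 ! p ! Suc i = 1 \<and> T2 ! p' ! i = 2} = {}"
    by (auto simp: T2_def less_Suc_eq)
  ultimately show "inversions [replicate m 2, replicate m 1] = m"
    unfolding inversions_def T2_def[symmetric] by (simp only: card card.empty add_0_right)
qed

section \<open>The exponent of a tableau and the tableau sum\<close>

context gap_params
begin

lemma ell_eq: "ell b k = l"
  using e b_eq k_eq by (auto simp: ell_def)

lemma
  assumes "parts_ordering (mu_conj b k r) lam"
  shows card_col: "1 \<le> i \<Longrightarrow> i \<le> l \<Longrightarrow> card (col lam i) = r i + r k"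
    and parts_le: "p < length lam \<Longrightarrow> lam ! p \<le> l"
proof -
  have card: "card (col lam i) = mu_conj b k r i" if "1 \<le> i" for i
    using assms that by (simp add: parts_ordering_def col_def length_filter_conv_card)
  then show "1 \<le> i \<Longrightarrow> i \<le> l \<Longrightarrow> card (col lam i) = r i + r k"
    by (simp add: mu_conj_def ell_eq)
  have "card (col lam (Suc l)) = 0"
    using card[of "Suc l"] by (simp add: mu_conj_def ell_eq)
  then have "col lam (Suc l) = {}" by simp
  then show "p < length lam \<Longrightarrow> lam ! p \<le> l" by (auto simp: col_def not_less_eq_eq)
qed

text \<open>By \<open>inversions_eq\<close>, column i contributes c_i (r_i + s - c_i) - asc_i to the
  inversions, at most the binomial summand of n(mu). In the exponent n(mu) cancels, and r_i^2 + s
  c_i - c_i (r_i + s - c_i) is \<open>quad\<close> of r_i and c_i.\<close>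

lemma
  assumes lam: "parts_ordering (mu_conj b k r) lam" and T: "T \<in> tableaux lam M"
  shows coinv_nonneg: "coinv b k r T \<ge> 0"
    and expo_eq: "expo b k r M T = int ((\<Sum>i=Suc l..k. r i ^ 2) +
      (\<Sum>i=1..l. set_exp (col lam) r i (ones_col T (Suc i)) (ones_col T i)))"
proof -
  note card = card_col[OF lam] and le = parts_le[OF lam]
  have T': "T \<in> row_tableaux lam" and M: "M = (\<Sum>i=1..l. card (ones_col T i))"
    using T sum_ones_col[OF _ le, of T] by (auto simp: tableaux_eq)
  define c where "c i = card (ones_col T i)" for i
  define asc where "asc i = ascents (ones_col T i - ones_col T (Suc i)) (col lam i - ones_col T i)" for i
  have c_le: "c i \<le> r i + r k"
    and card_twos: "card (col lam i - ones_col T i) = r i + r k - c i" if "i \<in> {1..l}" for i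
    using card[of i] that card_mono[OF finite_col ones_col_subset_col[OF T', of i]]
      card_Diff_subset[OF finite_ones_col ones_col_subset_col[OF T', of i]]
    by (simp_all add: c_def)
  have inv: "inversions T + (\<Sum>i=1..l. asc i) = (\<Sum>i=1..l. c i * (r i + r k - c i))"
    using inversions_eq[OF T' le] card_twos by (simp add: c_def asc_def)
  also have "\<dots> \<le> (\<Sum>i=1..l. (r i + r k) choose 2)"
    using c_le by (intro sum_mono mult_diff_le_choose_two)
  finally have "inversions T \<le> n_mu b k r"
    by (simp add: n_mu_def ell_eq)
  then show "coinv b k r T \<ge> 0"
    by (simp add: coinv_def)
  have "int (inversions T) = (\<Sum>i=1..l. int (c i) * (int (r i) + int (r k) - int (c i)) - int (asc i))"
  proof -
    have "int (inversions T) = int (\<Sum>i=1..l. c i * (r i + r k - c i)) - int (\<Sum>i=1..l. asc i)"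
      unfolding inv[symmetric] by simp
    also have "int (\<Sum>i=1..l. c i * (r i + r k - c i)) =
        (\<Sum>i=1..l. int (c i) * (int (r i) + int (r k) - int (c i)))"
      using c_le by (simp add: of_nat_diff)
    finally show ?thesis by (simp add: sum_subtractf)
  qed
  moreover have "(\<Sum>i=1..k. int (r i) ^ 2) =
      (\<Sum>i=1..l. int (r i) ^ 2) + (\<Sum>i=Suc l..k. int (r i) ^ 2)"
    using sum.ub_add_nat[of 1 l "\<lambda>i. int (r i) ^ 2" "k - l"] l_le_k by simp
  ultimately have "expo b k r M T = (\<Sum>i=Suc l..k. int (r i) ^ 2) +
      (\<Sum>i=1..l. int (r i) ^ 2 + int (r k) * int (c i) -
        (int (c i) * (int (r i) + int (r k) - int (c i)) - int (asc i)))"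
    unfolding expo_def coinv_def M
    by (simp add: sum.distrib sum_subtractf sum_distrib_left c_def)
  also have "(\<Sum>i=1..l. int (r i) ^ 2 + int (r k) * int (c i) -
        (int (c i) * (int (r i) + int (r k) - int (c i)) - int (asc i))) =
      (\<Sum>i=1..l. int (set_exp (col lam) r i (ones_col T (Suc i)) (ones_col T i)))"
    by (intro sum.cong refl)
       (simp add: set_exp_def int_quad c_def asc_def power2_eq_square algebra_simps)
  finally show "expo b k r M T = int ((\<Sum>i=Suc l..k. r i ^ 2) +
      (\<Sum>i=1..l. set_exp (col lam) r i (ones_col T (Suc i)) (ones_col T i)))"
    by simp
qed

text \<open>The polynomial on the right does not mention \<open>lam\<close>, so independence of the
  order holds for each M separately.\<close>

lemma tableau_sum_eq:
  assumes lam: "parts_ordering (mu_conj b k r) lam"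
  shows "tableau_sum b k r lam M = fps_X ^ (\<Sum>i=Suc l..k. r i ^ 2) *
    coeff (chain_sum (num_step r (r k)) (\<lambda>i c' c. monom (num_weight r (r k) i c' c) c) l 0) M"
proof -
  let ?E = "\<lambda>T. \<Sum>i=1..l. set_exp (col lam) r i (ones_col T (Suc i)) (ones_col T i)"
  let ?M = "\<lambda>T. sum_list (map (\<lambda>R. count_list R 1) T)"
  have "tableau_sum b k r lam M = (\<Sum>T\<in>tableaux lam M. fps_X ^ (\<Sum>i=Suc l..k. r i ^ 2) * fps_X ^ ?E T)"
    unfolding tableau_sum_def
    by (intro sum.cong refl) (simp only: expo_eq[OF lam] nat_int power_add)
  also have "\<dots> = fps_X ^ (\<Sum>i=Suc l..k. r i ^ 2) *
      (\<Sum>T\<in>row_tableaux lam. if ?M T = M then fps_X ^ ?E T else 0)"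
    unfolding tableaux_eq sum_distrib_left[symmetric]
    by (subst sum.inter_filter) (simp_all add: finite_row_tableaux)
  also have "(\<Sum>T\<in>row_tableaux lam. if ?M T = M then fps_X ^ ?E T else 0 :: rat fps) =
      coeff (\<Sum>T\<in>row_tableaux lam. monom (fps_X ^ ?E T) (?M T)) M"
    by (simp only: coeff_sum coeff_monom)
  also have "(\<Sum>T\<in>row_tableaux lam. monom (fps_X ^ ?E T) (?M T)) =
      chain_sum (num_step r (r k)) (\<lambda>i c' c. monom (num_weight r (r k) i c' c) c) l 0"
    using parts_le[OF lam] card_col[OF lam] by (rule sum_row_tableaux)
  finally show ?thesis .
qed

text \<open>Terms beyond the degree of the chain polynomial vanish, so the sum over M is the sum of
  its coefficients, its value at 1.\<close>

lemma infsum_tableau_sum: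
  assumes lam: "parts_ordering (mu_conj b k r) lam"
  shows "(\<Sum>\<^sub>\<infinity>M. tableau_sum b k r lam M) =
    fps_X ^ (\<Sum>i=Suc l..k. r i ^ 2) * chain_sum (num_step r (r k)) (num_weight r (r k)) l 0"
proof -
  let ?X = "fps_X ^ (\<Sum>i=Suc l..k. r i ^ 2) :: rat fps"
  let ?P = "chain_sum (num_step r (r k)) (\<lambda>i c' c. monom (num_weight r (r k) i c' c) c) l 0"
  have "(\<Sum>\<^sub>\<infinity>M. tableau_sum b k r lam M) = (\<Sum>\<^sub>\<infinity>M\<in>{..degree ?P}. tableau_sum b k r lam M)"
    by (rule infsum_cong_neutral) (auto simp: tableau_sum_eq[OF lam] coeff_eq_0)
  also have "\<dots> = ?X * (\<Sum>M\<le>degree ?P. coeff ?P M)"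
    by (simp add: tableau_sum_eq[OF lam] sum_distrib_left)
  also have "(\<Sum>M\<le>degree ?P. coeff ?P M) = poly ?P 1"
    by (simp add: poly_altdef)
  also have "\<dots> = chain_sum (num_step r (r k)) (num_weight r (r k)) l 0"
    by (simp add: poly_chain_sum poly_monom)
  finally show ?thesis .
qed

section \<open>Summation over the whole cone\<close>

definition seq_of :: "(int \<Rightarrow> int) \<Rightarrow> nat \<Rightarrow> nat" where
  "seq_of n j = (if j \<in> {1..k} then nat (n (Y j)) else 0)"

lemma seq_of_in_row_seqs: "n \<in> cone_points b \<Longrightarrow> seq_of n \<in> row_seqs k"
  using cone_pointsD(4) by (auto simp: row_seqs_def seq_of_def intro!: nat_mono)

lemma fibre_eq:
  assumes "r \<in> row_seqs k"
  shows "fibre r = {n \<in> cone_points b. seq_of n = r}"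
proof -
  have "(\<forall>j\<in>{1..k}. n (Y j) = int (r j)) \<longleftrightarrow> seq_of n = r" if "n \<in> cone_points b" for n
  proof -
    have "n (Y j) = int (r j) \<longleftrightarrow> nat (n (Y j)) = r j" for j
      using cone_pointsD(2)[OF that, of "Y j"] by auto
    then show ?thesis using assms by (auto simp: seq_of_def row_seqs_def fun_eq_iff)
  qed
  then show ?thesis by (auto simp: fibre_def)
qed

lemma in_fibre_seq_of: "n \<in> cone_points b \<Longrightarrow> n \<in> fibre (seq_of n)"
  by (simp add: fibre_eq seq_of_in_row_seqs)

lemma Q_nonneg: "n \<in> cone_points b \<Longrightarrow> Q b n \<ge> 0"
  by (simp only: Q_fibre[OF in_fibre_seq_of] of_nat_0_le_iff)

text \<open>r_1 is the largest entry, and the summand j = 1 of the form in \<open>Q_fibre\<close>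
  already dominates r_1 / 4.\<close>

lemma seq_of_le:
  assumes n: "n \<in> cone_points b"
  shows "seq_of n j \<le> 4 * nat (Q b n)"
proof -
  define r where "r = seq_of n"
  have r: "r \<in> row_seqs k" using seq_of_in_row_seqs[OF n] by (simp add: r_def)
  have "r (Suc i) \<le> r 1" if "Suc i \<le> k" for i
    using that
  proof (induction i)
    case (Suc i)
    moreover have "r (Suc (Suc i)) \<le> r (Suc i)" using r Suc.prems by (auto simp: row_seqs_def)
    ultimately show ?case by simp
  qed simp
  then have "r j \<le> r 1"
    using r by (cases "j \<in> {1..k}") (cases j, auto simp: row_seqs_def)
  also let ?c = "fst (pair_chain n 1) + snd (pair_chain n 1)"
  have "r 1 \<le> 4 * quad (r 1) ?c" by (rule le_4_quad)
  also have "quad (r 1) ?c \<le> (\<Sum>j=1..l. quad (r j) (fst (pair_chain n j) + snd (pair_chain n j)) +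
      cross (e = 1) r (r k) j (pair_chain n (Suc j)) (pair_chain n j))"
    using l_pos by (intro order_trans[OF _ member_le_sum[of 1]]) auto
  also have "\<dots> \<le> nat (Q b n)"
    unfolding Q_fibre[OF in_fibre_seq_of[OF n]] nat_int r_def by simp
  finally show ?thesis by (simp add: r_def)
qed

text \<open>Fibres are finite, and by \<open>seq_of_le\<close> only sequences with entries at most
  4N reach the coefficient of q^N. On each fibre both sides reduce to the same chain sum.\<close>

lemma Z_fibres:
  assumes lam: "\<And>r. r \<in> row_seqs k \<Longrightarrow> parts_ordering (mu_conj b k r) (lam r)"
  shows "Z_term b summable_on cone_points b"
    and "((\<lambda>r. 1 / qpoch (r 1) * (\<Prod>i=1..k-1. gauss_poly (r i) (r (i + 1))) *
           (\<Sum>\<^sub>\<infinity>M. tableau_sum b k r (lam r) M)) has_sum Z b) (row_seqs k)"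
proof -
  note * = fps_has_sum_fibres[where f = "Z_term b" and A = "cone_points b" and \<pi> = seq_of
      and B = "row_seqs k" and g = "\<lambda>r. 1 / qpoch (r 1) *
        (\<Prod>i=1..k-1. gauss_poly (r i) (r (i + 1))) * (\<Sum>\<^sub>\<infinity>M. tableau_sum b k r (lam r) M)"]
  have 1: "finite {n \<in> cone_points b. seq_of n = r}" if "r \<in> row_seqs k" for r
    using finite_fibre[OF that] fibre_eq[OF that] by simp
  have 2: "finite {r \<in> row_seqs k. \<exists>n\<in>cone_points b. seq_of n = r \<and> fps_nth (Z_term b n) N \<noteq> 0}" for N
  proof (rule finite_subset)
    show "{r \<in> row_seqs k. \<exists>n\<in>cone_points b. seq_of n = r \<and> fps_nth (Z_term b n) N \<noteq> 0} \<subseteq>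
      {r. \<forall>j. (j \<in> {1..k} \<longrightarrow> r j \<in> {..4 * N}) \<and> (j \<notin> {1..k} \<longrightarrow> r j = 0)}"
    proof (intro subsetI CollectI allI conjI impI)
      fix r j
      assume r: "r \<in> {r \<in> row_seqs k. \<exists>n\<in>cone_points b. seq_of n = r \<and> fps_nth (Z_term b n) N \<noteq> 0}"
      then obtain n where n: "n \<in> cone_points b" "seq_of n = r" "fps_nth (Z_term b n) N \<noteq> 0"
        by auto
      \<comment> \<open>The term is a multiple of q^Q, so its N-th coefficient vanishes for N <
        Q.\<close>
      then have "nat (Q b n) \<le> N"
        by (auto simp: Z_term_def fps_X_power_mult_nth split: if_splits)
      then show "r j \<in> {..4 * N}" using seq_of_le[OF n(1), of j] n(2) by simp
      show "r j = 0" if "j \<notin> {1..k}" using r that by (auto simp: row_seqs_def)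
    qed
  qed (rule finite_set_of_finite_funs; simp)
  have 3: "1 / qpoch (r 1) * (\<Prod>i=1..k-1. gauss_poly (r i) (r (i + 1))) *
      (\<Sum>\<^sub>\<infinity>M. tableau_sum b k r (lam r) M) = (\<Sum>n | n \<in> cone_points b \<and> seq_of n = r. Z_term b n)"
    if r: "r \<in> row_seqs k" for r
    using sum_Z_term_fibre[OF r] fibre_eq[OF r] infsum_tableau_sum[OF lam[OF r]]
    by (simp add: mult_ac)
  show "Z_term b summable_on cone_points b"
    using 1 2 3 seq_of_in_row_seqs by (rule *(1)[rotated])
  show "((\<lambda>r. 1 / qpoch (r 1) * (\<Prod>i=1..k-1. gauss_poly (r i) (r (i + 1))) *
           (\<Sum>\<^sub>\<infinity>M. tableau_sum b k r (lam r) M)) has_sum Z b) (row_seqs k)"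
    unfolding Z_def using 1 2 3 seq_of_in_row_seqs by (rule *(2)[rotated])
qed

text \<open>For r = (1, ..., 1) all l conjugate parts are 2, so mu = (l, l). The parts being equal,
  both length lists are [l, l], and the dependence shows when the two rows themselves are
  exchanged.\<close>

lemma inversions_depend_on_ordering:
  "\<exists>r\<in>row_seqs k. \<exists>lam1 lam2 M. \<exists>T1\<in>tableaux lam1 M. \<exists>T2\<in>tableaux lam2 M.
     parts_ordering (mu_conj b k r) lam1 \<and> parts_ordering (mu_conj b k r) lam2 \<and>
     mset T1 = mset T2 \<and> inversions T1 \<noteq> inversions T2"
proof -
  let ?r = "\<lambda>i. if i \<in> {1..k} then 1 else 0 :: nat"
  let ?T1 = "[replicate l 1, replicate l 2] :: nat list list"
  let ?T2 = "[replicate l 2, replicate l 1] :: nat list list"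
  have r: "?r \<in> row_seqs k" by (auto simp: row_seqs_def)
  have T: "?T1 \<in> tableaux [l, l] l" "?T2 \<in> tableaux [l, l] l"
    by (auto simp: tableaux_def one_row_ssyt_def count_list_replicate)
  have lam: "parts_ordering (mu_conj b k ?r) [l, l]"
    using l_pos l_le_k k_pos by (auto simp: parts_ordering_def mu_conj_def ell_eq)
  have "mset ?T1 = mset ?T2" by simp
  moreover have "inversions ?T1 \<noteq> inversions ?T2"
    using l_pos by (simp only: inversions_two_rows)
  ultimately have "parts_ordering (mu_conj b k ?r) [l, l] \<and> parts_ordering (mu_conj b k ?r) [l, l] \<and>
      mset ?T1 = mset ?T2 \<and> inversions ?T1 \<noteq> inversions ?T2"
    using lam by blast
  then show ?thesis
    by (intro bexI[OF _ r] exI[of _ "[l, l]"] exI[of _ l]) (rule bexI[OF _ T(1)], rule bexI[OF _ T(2)])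
qed

end

text \<open>For b = 3k - 1 the remainder is e = 2, and b > 3 ensures l >= 1.\<close>

lemma gap_params_ell:
  assumes "b > 3" "k > 0" "b = 3 * k + 1 \<or> b = 3 * k - 1"
  shows "gap_params b (ell b k) (b - 3 * ell b k) k"
  using assms by unfold_locales (auto simp: ell_def)

theorem corollary1p4:
  fixes b k :: nat
    and lam :: "(nat \<Rightarrow> nat) \<Rightarrow> nat list"
  assumes "b > 3" and "coprime b 3" and "k > 0" and "b = 3 * k + 1 \<or> b = 3 * k - 1"
    and lam: "\<And>r. r \<in> row_seqs k \<Longrightarrow> parts_ordering (mu_conj b k r) (lam r)"
  shows
    "\<comment> \<open>the series defining \<open>Z\<close> is well defined\<close>
     (\<forall>n\<in>cone_points b. Q b n \<ge> 0) \<and> Z_term b summable_on cone_points b \<and>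
     \<comment> \<open>the identity\<close>
     ((\<lambda>r. 1 / qpoch (r 1) * (\<Prod>i=1..k-1. gauss_poly (r i) (r (i + 1))) *
           (\<Sum>\<^sub>\<infinity>M. tableau_sum b k r (lam r) M)) has_sum Z b) (row_seqs k) \<and>
     \<comment> \<open>\<open>coinv\<close> and the exponents are nonnegative\<close>
     (\<forall>r\<in>row_seqs k. \<forall>M. \<forall>T\<in>tableaux (lam r) M. coinv b k r T \<ge> 0 \<and> expo b k r M T \<ge> 0) \<and>
     \<comment> \<open>\<open>inversions\<close> depends on the ordering of the parts, but the sum over tableaux does not\<close>
     (\<exists>r\<in>row_seqs k. \<exists>lam1 lam2 M. \<exists>T1\<in>tableaux lam1 M. \<exists>T2\<in>tableaux lam2 M.
        parts_ordering (mu_conj b k r) lam1 \<and> parts_ordering (mu_conj b k r) lam2 \<and>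
        mset T1 = mset T2 \<and> inversions T1 \<noteq> inversions T2) \<and>
     (\<forall>r\<in>row_seqs k. \<forall>lam1 lam2 M.
        parts_ordering (mu_conj b k r) lam1 \<longrightarrow> parts_ordering (mu_conj b k r) lam2 \<longrightarrow>
        tableau_sum b k r lam1 M = tableau_sum b k r lam2 M)"
proof -
  interpret gap_params b "ell b k" "b - 3 * ell b k" k
    using assms by (intro gap_params_ell)
  show ?thesis
  proof (intro conjI ballI allI impI)
    show "Q b n \<ge> 0" if "n \<in> cone_points b" for n using that by (rule Q_nonneg)
    show "Z_term b summable_on cone_points b" using lam by (rule Z_fibres(1))
    show "((\<lambda>r. 1 / qpoch (r 1) * (\<Prod>i=1..k-1. gauss_poly (r i) (r (i + 1))) *
           (\<Sum>\<^sub>\<infinity>M. tableau_sum b k r (lam r) M)) has_sum Z b) (row_seqs k)"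
      using lam by (rule Z_fibres(2))
    show "coinv b k r T \<ge> 0" if "r \<in> row_seqs k" "T \<in> tableaux (lam r) M" for r M T
      using lam[OF that(1)] that(2) by (rule coinv_nonneg)
    show "expo b k r M T \<ge> 0" if "r \<in> row_seqs k" "T \<in> tableaux (lam r) M" for r M T
      by (simp only: expo_eq[OF lam[OF that(1)] that(2)] of_nat_0_le_iff)
    show "\<exists>r\<in>row_seqs k. \<exists>lam1 lam2 M. \<exists>T1\<in>tableaux lam1 M. \<exists>T2\<in>tableaux lam2 M.
        parts_ordering (mu_conj b k r) lam1 \<and> parts_ordering (mu_conj b k r) lam2 \<and>
        mset T1 = mset T2 \<and> inversions T1 \<noteq> inversions T2"
      by (rule inversions_depend_on_ordering)
    show "tableau_sum b k r lam1 M = tableau_sum b k r lam2 M"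
      if "parts_ordering (mu_conj b k r) lam1" "parts_ordering (mu_conj b k r) lam2" for r lam1 lam2 M
      using that by (simp only: tableau_sum_eq)
  qed
qed

end
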